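(* Let $\mathbb{T}_{\sqrt 2}=\{(x,y,z)\in\mathbb{R}^3 : (\sqrt{x^2+y^2}-\sqrt2)^2+z^2=1\}$ be the torus of revolution whose generating circle has radius $1$ and is centered at distance $\sqrt{2}$ from the axis of revolution, endowed with the Riemannian metric induced from $\mathbb{R}^3$. Then the first (non-trivial) eigenvalue $\lambda_1(\mathbb{T}_{\sqrt2})$ of its Laplace operator satisfies $$\lambda_1(\mathbb{T}_{\sqrt 2}) < \frac{4}{3}(\sqrt{2}-1).$$
   Context: $\lambda_1(\mathbb{T}_{\sqrt2})$ is the smallest positive number $\lambda$ such that $\Delta f+\lambda f=0$ for some non-zero smooth function $f$ on $\mathbb{T}_{\sqrt 2}$, where $\Delta=\mathrm{div}\,\nabla$ is the Laplace operator of the induced metric. *)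

theory Defs
  imports "HOL-Analysis.Analysis"
begin

section \<open>Smooth functions on a subset of Euclidean space\<close>

text \<open>Intended for open \<open>U\<close>: \<open>f\<close> has continuous partial derivatives up to order \<open>n\<close> on \<open>U\<close>.\<close>

fun Ck_on :: "nat \<Rightarrow> ('a::euclidean_space \<Rightarrow> real) \<Rightarrow> 'a set \<Rightarrow> bool" where
  "Ck_on 0 f U \<longleftrightarrow> continuous_on U f"
| "Ck_on (Suc n) f U \<longleftrightarrow> (\<forall>x\<in>U. f differentiable (at x)) \<and>
     (\<forall>b\<in>Basis. Ck_on n (\<lambda>x. frechet_derivative f (at x) b) U)"

definition smooth_on_open :: "('a::euclidean_space \<Rightarrow> real) \<Rightarrow> 'a set \<Rightarrow> bool" where
  "smooth_on_open f U \<longleftrightarrow> (\<forall>n. Ck_on n f U)"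

definition smooth_function_on :: "'a::euclidean_space set \<Rightarrow> ('a \<Rightarrow> real) \<Rightarrow> bool" where
  "smooth_function_on S f \<longleftrightarrow>
     (\<forall>p\<in>S. \<exists>U F. open U \<and> p \<in> U \<and> smooth_on_open F U \<and> (\<forall>q\<in>S \<inter> U. F q = f q))"

section \<open>Calculus on an embedded submanifold with the induced metric\<close>

text \<open>
  In what follows \<open>S\<close> is meant to be a smooth embedded submanifold of a Euclidean space. Its
  Riemannian metric is the restriction of the ambient inner product to the tangent spaces, and
  functions and vector fields on \<open>S\<close> enter only through their values on \<open>S\<close>.

  Only the germ of a curve at \<open>0\<close> matters, so curves are taken to be defined on all of \<open>\<real>\<close>
  and are only required to be differentiable at \<open>0\<close>.
\<close>

definition curve_in ::
  "'a::euclidean_space set \<Rightarrow> 'a \<Rightarrow> 'a \<Rightarrow> (real \<Rightarrow> 'a) \<Rightarrow> bool" where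
  "curve_in S p v \<gamma> \<longleftrightarrow>
     (\<forall>t. \<gamma> t \<in> S) \<and> \<gamma> 0 = p \<and> (\<gamma> has_vector_derivative v) (at 0)"

definition tangent_space :: "'a::euclidean_space set \<Rightarrow> 'a \<Rightarrow> 'a set" where
  "tangent_space S p = {v. \<exists>\<gamma>. curve_in S p v \<gamma>}"

definition deriv_along ::
  "'a::euclidean_space set \<Rightarrow> ('a \<Rightarrow> 'b::real_normed_vector) \<Rightarrow> 'a \<Rightarrow> 'a \<Rightarrow> 'b" where
  "deriv_along S F p v =
     (THE d. \<forall>\<gamma>. curve_in S p v \<gamma> \<longrightarrow> ((F \<circ> \<gamma>) has_vector_derivative d) (at 0))"

definition gradient :: "'a::euclidean_space set \<Rightarrow> ('a \<Rightarrow> real) \<Rightarrow> 'a \<Rightarrow> 'a" where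
  "gradient S f p =
     (THE g. g \<in> tangent_space S p \<and> (\<forall>v\<in>tangent_space S p. g \<bullet> v = deriv_along S f p v))"

definition orth_proj :: "'a::euclidean_space set \<Rightarrow> 'a \<Rightarrow> 'a" where
  "orth_proj V x = (THE w. w \<in> V \<and> (\<forall>u\<in>V. (x - w) \<bullet> u = 0))"

text \<open>
  By the Gauss formula, the Levi-Civita connection of the induced metric is the tangential part
  of the ambient directional derivative.
\<close>

definition covariant_deriv ::
  "'a::euclidean_space set \<Rightarrow> ('a \<Rightarrow> 'a) \<Rightarrow> 'a \<Rightarrow> 'a \<Rightarrow> 'a" where
  "covariant_deriv S X p v = orth_proj (tangent_space S p) (deriv_along S X p v)"

definition orthonormal_basis_of :: "'a::euclidean_space set \<Rightarrow> 'a set \<Rightarrow> bool" where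
  "orthonormal_basis_of V B \<longleftrightarrow>
     pairwise orthogonal B \<and> (\<forall>e\<in>B. norm e = 1) \<and> span B = V"

text \<open>
  The divergence of \<open>X\<close> is the trace of \<open>v \<mapsto> \<nabla>\<^sub>v X\<close> on the tangent space; the trace of a
  linear map does not depend on the orthonormal basis that is chosen.
\<close>

definition divergence :: "'a::euclidean_space set \<Rightarrow> ('a \<Rightarrow> 'a) \<Rightarrow> 'a \<Rightarrow> real" where
  "divergence S X p =
     (\<Sum>e\<in>(SOME B. orthonormal_basis_of (tangent_space S p) B). covariant_deriv S X p e \<bullet> e)"

definition laplacian :: "'a::euclidean_space set \<Rightarrow> ('a \<Rightarrow> real) \<Rightarrow> 'a \<Rightarrow> real" where
  "laplacian S f = divergence S (gradient S f)"

section \<open>The first eigenvalue\<close>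

definition laplace_eigenvalue :: "'a::euclidean_space set \<Rightarrow> real \<Rightarrow> bool" where
  "laplace_eigenvalue S l \<longleftrightarrow>
     (\<exists>f. smooth_function_on S f \<and> (\<exists>p\<in>S. f p \<noteq> 0) \<and>
          (\<forall>p\<in>S. laplacian S f p + l * f p = 0))"

definition first_eigenvalue :: "'a::euclidean_space set \<Rightarrow> real" where
  "first_eigenvalue S = (LEAST l. 0 < l \<and> laplace_eigenvalue S l)"

definition torus_sqrt2 :: "(real^3) set" where
  "torus_sqrt2 = {p. (sqrt ((p $ 1)\<^sup>2 + (p $ 2)\<^sup>2) - sqrt 2)\<^sup>2 + (p $ 3)\<^sup>2 = 1}"

end

(*
In the angular coordinates (u, v) the Laplacian of the torus is h_uu/r^2 + h_vv - (sin v/r) h_v with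
r = sqrt 2 + cos v.  Look for eigenfunctions cos u * phi(v): for every l let phi be the solution of
(r phi')' = (1/r - l r) phi that is even at 0.  Let L be the first l > 0 at which phi'(pi) = 0; then
cos u * phi(v) is a smooth eigenfunction, and Picone's identity with the test function r, of Rayleigh
quotient 3/7, gives L <= 3/7.  Conversely L is the least positive eigenvalue.  For 0 < l < L the
function phi(v) sin u is a positive supersolution on each half torus, so the odd part of an
eigenfunction about any meridian vanishes (Picone's identity once more), the eigenfunction is
rotationally symmetric, and a Pruefer angle estimate excludes rotationally symmetric eigenfunctions with
0 < l < 4/9.  Finally 3/7 < 4/3 (sqrt 2 - 1).
*)
theory Submission
  imports Defs
begin

section \<open>Linear systems of two differential equations\<close>

text \<open>\<open>first_eigenvalue\<close> is a \<open>LEAST\<close> over the reals, so a Rayleigh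
  quotient estimate by itself says nothing about it: an attained minimum has to be exhibited. This
  forces both halves, an explicit eigenfunction at L and the exclusion of every positive l below L.
  Half tori enter because \<open>phi l v\<close> times sin u is positive only between two opposite
  meridians, and comparison with it requires functions vanishing on these; the odd parts of an
  eigenfunction do. A rotationally symmetric function has no odd part, so this comparison cannot see
  it, and it needs its own estimate. The constants: over a full circle the integrals of r r'^2 + r
  and of r^3 are 3 sqrt 2 pi and 7 sqrt 2 pi, hence 3/7. The symmetric estimate works for
  frequencies below 2/3, that is for l < 4/9, which exceeds 3/7: at frequency 2/3 the comparison
  angle gains 2 pi/3 + ln (1 + sqrt 2) < pi over half of the generating circle.\<close>

definition rad :: "real \<Rightarrow> real" where "rad v = sqrt 2 + cos v"

text \<open>\<open>rad v\<close> is the distance from the axis, so the induced metric is (rad v)^2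
  du^2 + dv^2. The exact range is [sqrt 2 - 1, sqrt 2 + 1]; the rational ends are reciprocal to each
  other, so 5/2 also bounds \<open>1 / rad v\<close>.\<close>

lemma rad_bounds: "2/5 \<le> rad v" "rad v \<le> 5/2"
proof -
  have "7/5 \<le> sqrt (2::real)" by (rule real_le_rsqrt) (simp add: power2_eq_square)
  moreover have "sqrt (2::real) \<le> 3/2" by (rule real_le_lsqrt) (simp_all add: power2_eq_square)
  ultimately show "2/5 \<le> rad v" "rad v \<le> 5/2"
    unfolding rad_def using cos_ge_minus_one[of v] cos_le_one[of v] by linarith+
qed

lemma rad_pos [simp]: "0 < rad v" "rad v \<noteq> 0" "0 \<le> rad v"
  using rad_bounds(1)[of v] by linarith+

lemma inverse_rad_le: "1 / rad v \<le> 5/2"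
  using rad_bounds(1)[of v] by (simp add: field_simps)

lemma rad_minus [simp]: "rad (- v) = rad v" by (simp add: rad_def)
lemma rad_periodic [simp]: "rad (v + 2 * pi) = rad v" by (simp add: rad_def)

lemma rad_reflect [simp]: "rad (2 * pi - v) = rad v"
  by (simp add: rad_def cos_diff)

lemma DERIV_rad [derivative_intros]:
  "(f has_real_derivative D) (at x within s) \<Longrightarrow>
     ((\<lambda>x. rad (f x)) has_real_derivative (- sin (f x) * D)) (at x within s)"
  unfolding rad_def by (auto intro!: derivative_eq_intros)

lemma continuous_on_rad [continuous_intros]:
  fixes f :: "'a::t2_space \<Rightarrow> real"
  shows "continuous_on s f \<Longrightarrow> continuous_on s (\<lambda>x. rad (f x))"
  unfolding rad_def by (auto intro!: continuous_intros)

text \<open>The difference of two integrals is the oriented integral from \<open>0\<close>: one of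
  the two intervals is always empty or a point. Near a given \<open>t\<close> it is rewritten with
  base point \<open>-R\<close>, which avoids one-sided derivatives at \<open>0\<close>.\<close>

lemma antiderivative_exists:
  fixes g :: "real \<Rightarrow> real"
  assumes "continuous_on UNIV g"
  shows "\<exists>G. G 0 = 0 \<and> (\<forall>t. (G has_real_derivative g t) (at t))"
proof -
  define G where "G t = integral {0..t} g - integral {t..0} g" for t
  have int: "g integrable_on {a..b}" for a b
    using assms continuous_on_subset integrable_continuous_real by blast
  have "(G has_real_derivative g t) (at t)" for t
  proof -
    define R where "R = \<bar>t\<bar> + 1"
    have eq: "integral {-R..s} g - integral {-R..0} g = G s" if s: "s \<in> {-R<..<R}" for s
    proof (cases "0 \<le> s")
      case True
      then have "integral {-R..0} g + integral {0..s} g = integral {-R..s} g"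
        by (intro Henstock_Kurzweil_Integration.integral_combine int) (auto simp: R_def)
      moreover have "integral {s..0} g = 0" using True by (cases "s = 0") auto
      ultimately show ?thesis by (simp add: G_def)
    next
      case False
      then have "integral {-R..s} g + integral {s..0} g = integral {-R..0} g"
        using s by (intro Henstock_Kurzweil_Integration.integral_combine int) auto
      then show ?thesis using False by (simp add: G_def)
    qed
    have t: "t \<in> {-R<..<R}" by (auto simp: R_def)
    have "((\<lambda>s. integral {-R..s} g) has_real_derivative g t) (at t within {-R..R})"
      using t assms continuous_on_subset
      by (intro integral_has_real_derivative) auto
    then have "((\<lambda>s. integral {-R..s} g) has_real_derivative g t) (at t)"
      using t by (metis at_within_Icc_at greaterThanLessThan_iff)
    then have "((\<lambda>s. integral {-R..s} g - integral {-R..0} g) has_real_derivative g t) (at t)"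
      by (auto intro!: derivative_eq_intros)
    then show ?thesis
      using has_field_derivative_transform_within_open[OF _ _ t eq] by auto
  qed
  moreover have "G 0 = 0" by (simp add: G_def)
  ultimately show ?thesis by blast
qed

text \<open>One Picard step: integrating M times a Taylor term of exp (M |t|) gives the next Taylor
  term. Negative times are reduced to positive ones by t -> -t.\<close>

lemma power_fact_antiderivative_bound:
  fixes F :: "real \<Rightarrow> real"
  assumes d: "\<And>t. (F has_real_derivative F' t) (at t)" and "F 0 = 0"
    and b: "\<And>t. \<bar>F' t\<bar> \<le> M * ((M * \<bar>t\<bar>) ^ n / fact n)"
  shows "\<bar>F t\<bar> \<le> (M * \<bar>t\<bar>) ^ Suc n / fact (Suc n)"
proof -
  have pos: "\<bar>H s\<bar> \<le> (M * s) ^ Suc n / fact (Suc n)"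
    if d: "\<And>t. (H has_real_derivative H' t) (at t)" and H0: "H 0 = 0"
      and b: "\<And>t. \<bar>H' t\<bar> \<le> M * ((M * \<bar>t\<bar>) ^ n / fact n)" and s: "0 < s" for H H' s
  proof -
    let ?p = "\<lambda>t. (M * t) ^ Suc n / fact (Suc n)"
    have p: "(?p has_real_derivative M * ((M * t) ^ n / fact n)) (at t)" for t
    proof -
      have e: "real (Suc n) * (M * t) ^ n * M / fact (Suc n) = M * ((M * t) ^ n / fact n)"
        by (simp add: field_simps del: of_nat_Suc)
      have "(?p has_real_derivative real (Suc n) * (M * t) ^ n * M / fact (Suc n)) (at t)"
        by (rule derivative_eq_intros refl | simp)+
      then show ?thesis unfolding e .
    qed
    have "norm (H s - H 0) \<le> ?p s - ?p 0"
    proof (rule differentiable_bound_general[OF s])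
      show "continuous_on {0..s} H" "continuous_on {0..s} ?p"
        using d p by (meson DERIV_isCont continuous_at_imp_continuous_on)+
      show "(H has_vector_derivative H' x) (at x)" for x
        using d by (simp add: has_real_derivative_iff_has_vector_derivative)
      show "(?p has_vector_derivative M * ((M * x) ^ n / fact n)) (at x)" for x
        using p by (simp add: has_real_derivative_iff_has_vector_derivative)
      show "norm (H' x) \<le> M * ((M * x) ^ n / fact n)" if "0 < x" for x
        using b[of x] that by simp
    qed
    then show ?thesis using H0 by simp
  qed
  consider "t = 0" | "0 < t" | "0 < - t" by linarith
  then show ?thesis
  proof cases
    case 1 then show ?thesis using assms by simp
  next
    case 2 then show ?thesis using pos[OF d \<open>F 0 = 0\<close> b 2] by simp
  next
    case 3
    have "((\<lambda>t. F (- t)) has_real_derivative - F' (- t)) (at t)" for t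
      using d[of "-t"] by (simp add: DERIV_mirror)
    from pos[OF this _ _ 3] b[of "- t" for t] \<open>F 0 = 0\<close> 3 show ?thesis by simp
  qed
qed

text \<open>Picard iteration on the whole line. Since the coefficients are bounded by M, the
  iterated integrals are dominated by the Taylor terms of exp (M |t|), so the series may be
  differentiated termwise on compact intervals.\<close>

lemma linear_system_exists:
  fixes p q :: "real \<Rightarrow> real"
  assumes p: "continuous_on UNIV p" and q: "continuous_on UNIV q"
    and M: "\<And>t. \<bar>p t\<bar> \<le> M" "\<And>t. \<bar>q t\<bar> \<le> M"
  obtains x y where "x 0 = 1" "y 0 = 0"
    "\<And>t. (x has_real_derivative p t * y t) (at t)"
    "\<And>t. (y has_real_derivative q t * x t) (at t)"
proof -
  define A where "A g = (SOME G::real\<Rightarrow>real. G 0 = 0 \<and> (\<forall>t. (G has_real_derivative g t) (at t)))"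
    for g :: "real \<Rightarrow> real"
  have A: "A g 0 = 0" "(A g has_real_derivative g t) (at t)" if "continuous_on UNIV g" for g t
    using someI_ex[OF antiderivative_exists[OF that]] unfolding A_def by auto
  \<comment> \<open>These are the increments of the Picard iteration started at the constant (1, 0),
    not the iterates; the solution is their sum.\<close>
  define z where "z = rec_nat ((\<lambda>t. 1, \<lambda>t. 0) :: (real\<Rightarrow>real)\<times>(real\<Rightarrow>real))
    (\<lambda>n z. (A (\<lambda>t. p t * snd z t), A (\<lambda>t. q t * fst z t)))"
  define f where "f n = fst (z n)" for n
  define g where "g n = snd (z n)" for n
  have rec: "f 0 = (\<lambda>t. 1)" "g 0 = (\<lambda>t. 0)" "f (Suc n) = A (\<lambda>t. p t * g n t)"
    "g (Suc n) = A (\<lambda>t. q t * f n t)" for n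
    by (auto simp: f_def g_def z_def)
  have M0: "0 \<le> M" using M(1)[of 0] by linarith
  have cont: "continuous_on UNIV (f n) \<and> continuous_on UNIV (g n)" for n
  proof (induction n)
    case 0 then show ?case by (simp add: rec)
  next
    case (Suc n)
    have "continuous_on UNIV (\<lambda>t. p t * g n t)" "continuous_on UNIV (\<lambda>t. q t * f n t)"
      using Suc p q by (auto intro: continuous_intros)
    from A(2)[OF this(1)] A(2)[OF this(2)] show ?case
      unfolding rec by (meson DERIV_isCont continuous_at_imp_continuous_on)
  qed
  have cpg: "continuous_on UNIV (\<lambda>t. p t * g n t)" and cqf: "continuous_on UNIV (\<lambda>t. q t * f n t)" for n
    using cont p q by (auto intro: continuous_intros)
  have df: "(f (Suc n) has_real_derivative p t * g n t) (at t)"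
    and dg: "(g (Suc n) has_real_derivative q t * f n t) (at t)" for n t
    unfolding rec using A(2)[OF cpg] A(2)[OF cqf] by auto
  have f0: "f (Suc n) 0 = 0" and g0: "g (Suc n) 0 = 0" for n
    unfolding rec using A(1)[OF cpg] A(1)[OF cqf] by auto
  have bound: "\<bar>f n t\<bar> \<le> (M * \<bar>t\<bar>) ^ n / fact n \<and> \<bar>g n t\<bar> \<le> (M * \<bar>t\<bar>) ^ n / fact n" for n t
  proof (induction n arbitrary: t)
    case 0 then show ?case by (simp add: rec)
  next
    case (Suc n)
    have "\<bar>p t * g n t\<bar> \<le> M * ((M * \<bar>t\<bar>) ^ n / fact n)"
      "\<bar>q t * f n t\<bar> \<le> M * ((M * \<bar>t\<bar>) ^ n / fact n)" for t
      unfolding abs_mult by (rule mult_mono; use M[of t] Suc[of t] M0 in simp)+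
    then show ?case
      using power_fact_antiderivative_bound[OF df f0] power_fact_antiderivative_bound[OF dg g0] by blast
  qed
  have sm: "summable (\<lambda>n. (M * R) ^ n / fact n)" for R :: real
    using summable_exp[of "M * R"] by (simp add: field_simps)
  have sumf: "summable (\<lambda>n. f n t)" and sumg: "summable (\<lambda>n. g n t)" for t
    by (rule summable_comparison_test'[OF sm[of "\<bar>t\<bar>"]], use bound in simp)+
  have key: "((\<lambda>t. \<Sum>n. F n t) has_real_derivative k t * (\<Sum>n. G n t)) (at t)"
    if F: "F 0 = (\<lambda>t. c)" "\<And>n t. (F (Suc n) has_real_derivative k t * G n t) (at t)"
      and k: "\<And>t. \<bar>k t\<bar> \<le> M" and G: "\<And>n t. \<bar>G n t\<bar> \<le> (M * \<bar>t\<bar>) ^ n / fact n"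
      and sF: "summable (\<lambda>n. F n 0)"
    for F G :: "nat \<Rightarrow> real \<Rightarrow> real" and k :: "real \<Rightarrow> real" and c t
  proof -
    \<comment> \<open>The index is shifted by one: the zeroth term is constant, and the derivative
      of term n + 1 is the coefficient times term n of the other component.\<close>
    define F' where "F' n t = (case n of 0 \<Rightarrow> 0 | Suc m \<Rightarrow> k t * G m t)" for n t
    define R where "R = \<bar>t\<bar> + 1"
    let ?S = "{-R..R}"
    let ?B = "\<lambda>n. case n of 0 \<Rightarrow> 0 | Suc m \<Rightarrow> M * ((M * R) ^ m / fact m)"
    have sG: "summable (\<lambda>n. G n t)"
      by (rule summable_comparison_test'[OF sm[of "\<bar>t\<bar>"]], use G in simp)
    have "summable ?B"
      by (subst summable_Suc_iff[symmetric]) (use summable_mult[OF sm, of M R] in simp)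
    moreover have "norm (F' n s) \<le> ?B n" if "s \<in> ?S" for n s
    proof (cases n)
      case (Suc m)
      have "\<bar>G m s\<bar> \<le> (M * R) ^ m / fact m"
      proof -
        have "(M * \<bar>s\<bar>) ^ m \<le> (M * R) ^ m"
          using that M0 by (intro power_mono mult_left_mono) auto
        then show ?thesis using G[of m s]
          by (meson divide_right_mono fact_ge_zero order_trans)
      qed
      from mult_mono[OF k[of s] this M0 abs_ge_zero]
      show ?thesis unfolding Suc F'_def by (simp only: real_norm_def abs_mult nat.case)
    qed (simp add: F'_def)
    ultimately have unif: "uniformly_convergent_on ?S (\<lambda>n s. \<Sum>i<n. F' i s)"
      by (intro Weierstrass_m_test') auto
    have "(F n has_real_derivative F' n s) (at s within ?S)" for n s
      using F by (cases n) (auto simp: F'_def intro: has_field_derivative_at_within)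
    then have "((\<lambda>t. \<Sum>n. F n t) has_real_derivative (\<Sum>n. F' n t)) (at t)"
      by (intro has_field_derivative_series'(2)[where S = ?S and ?x0.0 = 0] unif sF) (auto simp: R_def)
    moreover have "(\<Sum>n. F' n t) = k t * (\<Sum>n. G n t)"
    proof -
      have "(\<lambda>n. F' (Suc n) t) sums (k t * (\<Sum>n. G n t))"
        unfolding F'_def using sG by (auto intro: sums_mult summable_sums)
      then have "(\<lambda>n. F' n t) sums (k t * (\<Sum>n. G n t) + F' 0 t)" by (rule sums_Suc)
      then show ?thesis by (simp add: sums_iff F'_def)
    qed
    ultimately show ?thesis by simp
  qed
  show thesis
  proof (rule that[of "\<lambda>t. \<Sum>n. f n t" "\<lambda>t. \<Sum>n. g n t"])
    have "f n 0 = 0" "g n 0 = 0" if "n \<noteq> 0" for n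
      using that f0 g0 by (cases n, simp, simp)+
    then have "(\<lambda>n. f n 0) sums (f 0 0)" "(\<lambda>n. g n 0) sums (g 0 0)"
      using sums_finite[of "{0}" "\<lambda>n. f n 0"] sums_finite[of "{0}" "\<lambda>n. g n 0"] by simp_all
    then show "(\<Sum>n. f n 0) = 1" "(\<Sum>n. g n 0) = 0" by (auto simp: sums_iff rec)
    show "((\<lambda>t. \<Sum>n. f n t) has_real_derivative p t * (\<Sum>n. g n t)) (at t)" for t
      by (rule key[OF rec(1) df M(1) conjunct2[OF bound] sumf])
    show "((\<lambda>t. \<Sum>n. g n t) has_real_derivative q t * (\<Sum>n. f n t)) (at t)" for t
      by (rule key[OF rec(2) dg M(2) conjunct1[OF bound] sumg])
  qed
qed

text \<open>Gronwall in both time directions: E = x^2 + y^2 satisfies |E'| <= 2 M E, so E times exp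
  (-2 M t) cannot increase and E times exp (2 M t) cannot decrease.\<close>

lemma linear_system_unique_zero:
  fixes x y p q :: "real \<Rightarrow> real"
  assumes dx: "\<And>t. (x has_real_derivative p t * y t) (at t)"
    and dy: "\<And>t. (y has_real_derivative q t * x t) (at t)"
    and M: "\<And>t. \<bar>p t\<bar> \<le> M" "\<And>t. \<bar>q t\<bar> \<le> M"
    and z: "x s = 0" "y s = 0"
  shows "x t = 0 \<and> y t = 0"
proof -
  define E where "E t = (x t)\<^sup>2 + (y t)\<^sup>2" for t
  let ?E' = "\<lambda>t. 2 * (p t + q t) * (x t * y t)"
  have dE: "(E has_real_derivative ?E' t) (at t)" for t
    unfolding E_def by (rule derivative_eq_intros dx dy refl)+ (simp add: algebra_simps)
  have bE: "\<bar>?E' t\<bar> \<le> 2 * M * E t" for t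
  proof -
    have "\<bar>p t + q t\<bar> \<le> 2 * M" using M[of t] by linarith
    moreover have "2 * \<bar>x t * y t\<bar> \<le> E t"
      using zero_le_power2[of "\<bar>x t\<bar> - \<bar>y t\<bar>"] unfolding E_def
      by (simp add: power2_diff abs_mult)
    ultimately have "\<bar>p t + q t\<bar> * (2 * \<bar>x t * y t\<bar>) \<le> 2 * M * E t"
      using M(1)[of t] by (intro mult_mono) auto
    moreover have "\<bar>?E' t\<bar> = \<bar>p t + q t\<bar> * (2 * \<bar>x t * y t\<bar>)"
      by (simp only: abs_mult abs_numeral ac_simps)
    ultimately show ?thesis by linarith
  qed
  have "E t \<le> 0"
  proof (cases "s \<le> t")
    case True
    have "((\<lambda>t. exp (- 2 * M * t) * E t) has_real_derivative exp (- 2 * M * t) * (?E' t - 2 * M * E t)) (at t)" for t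
      by (rule derivative_eq_intros dE refl)+ (simp add: algebra_simps)
    moreover have "exp (- 2 * M * t) * (?E' t - 2 * M * E t) \<le> 0" for t
      using bE[of t] by (intro mult_nonneg_nonpos) auto
    ultimately have "exp (- 2 * M * t) * E t \<le> exp (- 2 * M * s) * E s"
      using DERIV_nonpos_imp_nonincreasing[OF True, of "\<lambda>t. exp (- 2 * M * t) * E t"] by blast
    then show ?thesis using z by (simp add: E_def mult_le_0_iff)
  next
    case False
    then have le: "t \<le> s" by simp
    have "((\<lambda>t. exp (2 * M * t) * E t) has_real_derivative exp (2 * M * t) * (?E' t + 2 * M * E t)) (at t)" for t
      by (rule derivative_eq_intros dE refl)+ (simp add: algebra_simps)
    moreover have "exp (2 * M * t) * (?E' t + 2 * M * E t) \<ge> 0" for t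
      using bE[of t] by (intro mult_nonneg_nonneg) auto
    ultimately have "exp (2 * M * t) * E t \<le> exp (2 * M * s) * E s"
      using DERIV_nonneg_imp_nondecreasing[OF le, of "\<lambda>t. exp (2 * M * t) * E t"] by blast
    then show ?thesis using z by (simp add: E_def mult_le_0_iff)
  qed
  then show ?thesis unfolding E_def
    by (metis add_nonneg_nonneg dual_order.antisym sum_power2_eq_zero_iff zero_le_power2)
qed

text \<open>Gronwall for the difference of two solutions whose systems differ only in
  \<open>q\<close>. The forcing term is at most e B in size, and 2 b c <= b^2 + c^2 turns it into
  the additive constant (e B)^2 at the cost of the extra 1 in the rate 2 M + 1.\<close>

lemma linear_system_perturb:
  fixes x y p q :: "real \<Rightarrow> real"
  assumes dx: "\<And>t. (x has_real_derivative p t * y t) (at t)"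
    and dy: "\<And>t. (y has_real_derivative q t * x t) (at t)"
    and dx': "\<And>t. (x' has_real_derivative p t * y' t) (at t)"
    and dy': "\<And>t. (y' has_real_derivative q' t * x' t) (at t)"
    and M: "\<And>t. \<bar>p t\<bar> \<le> M" "\<And>t. \<bar>q' t\<bar> \<le> M"
    and B: "\<And>t. t \<in> {0..T} \<Longrightarrow> \<bar>x t\<bar> \<le> B"
    and e: "\<And>t. \<bar>q t - q' t\<bar> \<le> e"
    and z: "x 0 = x' 0" "y 0 = y' 0" and t: "t \<in> {0..T}"
  shows "(x t - x' t)\<^sup>2 + (y t - y' t)\<^sup>2 \<le> (e * B)\<^sup>2 * exp ((2 * M + 1) * T)"
proof -
  define E where "E t = (x t - x' t)\<^sup>2 + (y t - y' t)\<^sup>2" for t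
  define K where "K = 2 * M + 1"
  let ?E' = "\<lambda>t. 2 * (p t + q' t) * ((x t - x' t) * (y t - y' t)) + 2 * ((y t - y' t) * ((q t - q' t) * x t))"
  have dE: "(E has_real_derivative ?E' t) (at t)" for t
    unfolding E_def by (rule derivative_eq_intros dx dy dx' dy' refl)+ (simp add: algebra_simps)
  have M0: "0 \<le> M" using M(1)[of 0] by linarith
  have e0: "0 \<le> e" using e[of 0] by linarith
  have bE: "?E' t \<le> K * (E t + (e * B)\<^sup>2)" if t: "t \<in> {0..T}" for t
  proof -
    let ?a = "x t - x' t" and ?b = "y t - y' t"
    have "\<bar>p t + q' t\<bar> \<le> 2 * M" using M[of t] by linarith
    moreover have "2 * \<bar>?a * ?b\<bar> \<le> E t"
      using zero_le_power2[of "\<bar>?a\<bar> - \<bar>?b\<bar>"] unfolding E_def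
      by (simp add: power2_diff abs_mult)
    ultimately have "\<bar>p t + q' t\<bar> * (2 * \<bar>?a * ?b\<bar>) \<le> 2 * M * E t"
      using M0 by (intro mult_mono) auto
    moreover have "\<bar>2 * (p t + q' t) * (?a * ?b)\<bar> = \<bar>p t + q' t\<bar> * (2 * \<bar>?a * ?b\<bar>)"
      by (simp only: abs_mult abs_numeral ac_simps)
    ultimately have 1: "2 * (p t + q' t) * (?a * ?b) \<le> 2 * M * E t"
      using abs_ge_self[of "2 * (p t + q' t) * (?a * ?b)"] by linarith
    let ?c = "(q t - q' t) * x t"
    have "\<bar>?c\<bar> \<le> e * B"
      unfolding abs_mult using e[of t] B[OF t] e0 by (intro mult_mono) auto
    then have "?c\<^sup>2 \<le> (e * B)\<^sup>2" by (metis abs_ge_zero power2_abs power_mono)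
    moreover have "2 * (?b * ?c) \<le> ?b\<^sup>2 + ?c\<^sup>2"
      using zero_le_power2[of "?b - ?c"] by (simp only: power2_diff mult.assoc)
    ultimately have 2: "2 * (?b * ?c) \<le> E t + (e * B)\<^sup>2"
      unfolding E_def using zero_le_power2[of ?a] by linarith
    have "0 \<le> 2 * M * (e * B)\<^sup>2" using M0 by simp
    then show ?thesis using 1 2 by (simp add: K_def algebra_simps)
  qed
  define F where "F t = exp (- K * t) * (E t + (e * B)\<^sup>2)" for t
  have dF: "(F has_real_derivative exp (- K * t) * (?E' t - K * (E t + (e * B)\<^sup>2))) (at t)" for t
    unfolding F_def by (rule derivative_eq_intros dE refl)+ (simp add: algebra_simps)
  have "F t \<le> F 0"
  proof (rule DERIV_nonpos_imp_nonincreasing[of 0 t F])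
    show "0 \<le> t" using t by simp
    fix s assume "0 \<le> s" "s \<le> t"
    then have "?E' s \<le> K * (E s + (e * B)\<^sup>2)" using t by (intro bE) auto
    then have "exp (- K * s) * (?E' s - K * (E s + (e * B)\<^sup>2)) \<le> 0"
      by (intro mult_nonneg_nonpos) (simp_all only: exp_ge_zero diff_le_0_iff_le)
    with dF[of s] show "\<exists>y. (F has_real_derivative y) (at s) \<and> y \<le> 0" by blast
  qed
  then have "exp (- (K * t)) * (E t + (e * B)\<^sup>2) \<le> (e * B)\<^sup>2"
    using z by (simp add: F_def E_def)
  then have "E t + (e * B)\<^sup>2 \<le> (e * B)\<^sup>2 * exp (K * t)"
    by (simp add: exp_minus field_simps)
  also have "\<dots> \<le> (e * B)\<^sup>2 * exp (K * T)"
    using t M0 by (intro mult_left_mono) (auto simp: K_def)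
  finally have "E t \<le> (e * B)\<^sup>2 * exp (K * T)"
    using zero_le_power2[of "e * B"] by linarith
  then show ?thesis
    unfolding E_def K_def .
qed

section \<open>The first mode\<close>

lemma field_derivative_eqI: "(f has_real_derivative D) F \<Longrightarrow> D = E \<Longrightarrow> (f has_real_derivative E) F"
  by simp

text \<open>Taking the flux r x' as second component gives a first-order system with bounded
  coefficients in which no derivative of \<open>rad\<close> appears. The initial values select the
  solution that is even at 0.\<close>

definition is_mode :: "real \<Rightarrow> (real \<Rightarrow> real) \<Rightarrow> (real \<Rightarrow> real) \<Rightarrow> bool" where
  "is_mode l x y \<longleftrightarrow> x 0 = 1 \<and> y 0 = 0 \<and>
     (\<forall>t. (x has_real_derivative 1 / rad t * y t) (at t)) \<and>
     (\<forall>t. (y has_real_derivative (1 / rad t - l * rad t) * x t) (at t))"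

text \<open>The term in \<open>l\<close> makes this the same bound as for the potential, since both
  coefficients of the system must share one M.\<close>

lemma abs_inverse_rad_le: "\<bar>1 / rad t\<bar> \<le> 5/2 + \<bar>l\<bar> * (5/2)"
  using inverse_rad_le[of t] by simp

lemma abs_potential_le: "\<bar>1 / rad t - l * rad t\<bar> \<le> 5/2 + \<bar>l\<bar> * (5/2)"
proof -
  have "\<bar>l * rad t\<bar> \<le> \<bar>l\<bar> * (5/2)"
    unfolding abs_mult using rad_bounds[of t] by (intro mult_left_mono) auto
  moreover have "\<bar>1 / rad t\<bar> \<le> 5/2" using inverse_rad_le[of t] by simp
  ultimately show ?thesis by linarith
qed

lemma is_mode_exists: "\<exists>x y. is_mode l x y"
proof -
  have c: "continuous_on UNIV (\<lambda>t. 1 / rad t)" "continuous_on UNIV (\<lambda>t. 1 / rad t - l * rad t)"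
    by (auto intro!: continuous_intros)
  obtain x y where "x 0 = 1" "y 0 = 0"
    "\<And>t. (x has_real_derivative 1 / rad t * y t) (at t)"
    "\<And>t. (y has_real_derivative (1 / rad t - l * rad t) * x t) (at t)"
    using linear_system_exists[OF c abs_inverse_rad_le abs_potential_le] by blast
  then show ?thesis unfolding is_mode_def by blast
qed

text \<open>Separating variables as \<open>cos u \<cdot> \<phi> v\<close> turns the eigenvalue equation into
  \<open>(r \<phi>')' = (1/r - l r) \<phi>\<close>; below \<open>\<chi> = r \<phi>'\<close>, and \<open>\<phi>\<close> is the solution that is even at \<open>0\<close>.\<close>

definition phi :: "real \<Rightarrow> real \<Rightarrow> real" where "phi l = (SOME x. \<exists>y. is_mode l x y)"
definition chi :: "real \<Rightarrow> real \<Rightarrow> real" where "chi l = (SOME y. is_mode l (phi l) y)"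

lemma is_mode_phi_chi: "is_mode l (phi l) (chi l)"
proof -
  have "\<exists>y. is_mode l (phi l) y"
    unfolding phi_def using someI_ex[of "\<lambda>x. \<exists>y. is_mode l x y", OF is_mode_exists] .
  then show ?thesis unfolding chi_def by (rule someI_ex)
qed

lemma phi_0 [simp]: "phi l 0 = 1" and chi_0 [simp]: "chi l 0 = 0"
  and DERIV_phi: "(phi l has_real_derivative 1 / rad t * chi l t) (at t)"
  and DERIV_chi: "(chi l has_real_derivative (1 / rad t - l * rad t) * phi l t) (at t)"
  using is_mode_phi_chi[of l] by (auto simp: is_mode_def)

lemma DERIV_phi_comp [derivative_intros]:
  "(f has_real_derivative D) (at x within s) \<Longrightarrow>
     ((\<lambda>x. phi l (f x)) has_real_derivative (1 / rad (f x) * chi l (f x) * D)) (at x within s)"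
  by (rule DERIV_chain2[OF DERIV_phi])

lemma DERIV_chi_comp [derivative_intros]:
  "(f has_real_derivative D) (at x within s) \<Longrightarrow>
     ((\<lambda>x. chi l (f x)) has_real_derivative ((1 / rad (f x) - l * rad (f x)) * phi l (f x) * D)) (at x within s)"
  by (rule DERIV_chain2[OF DERIV_chi])

lemma continuous_on_phi: "continuous_on s (phi l)" and continuous_on_chi: "continuous_on s (chi l)"
  by (meson DERIV_phi DERIV_chi DERIV_isCont continuous_at_imp_continuous_on)+

lemma continuous_on_phi_comp [continuous_intros]:
  "continuous_on s f \<Longrightarrow> continuous_on s (\<lambda>x. phi l (f x))"
  by (rule continuous_on_compose2[OF continuous_on_phi[of UNIV]]) auto

lemma continuous_on_chi_comp [continuous_intros]:
  "continuous_on s f \<Longrightarrow> continuous_on s (\<lambda>x. chi l (f x))"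
  by (rule continuous_on_compose2[OF continuous_on_chi[of UNIV]]) auto

text \<open>Agreement at a single point suffices. The reflections of a mode in 0 and in pi again
  solve the system, and are compared with the mode at their fixed points.\<close>

lemma mode_unique:
  assumes x: "\<And>t. (x has_real_derivative 1 / rad t * y t) (at t)"
    and y: "\<And>t. (y has_real_derivative (1 / rad t - l * rad t) * x t) (at t)"
    and s: "x s = phi l s" "y s = chi l s"
  shows "x t = phi l t \<and> y t = chi l t"
proof -
  have "((\<lambda>t. x t - phi l t) has_real_derivative 1 / rad t * (y t - chi l t)) (at t)" for t
    by (rule derivative_eq_intros x refl)+ (simp add: algebra_simps)
  moreover have "((\<lambda>t. y t - chi l t) has_real_derivative (1 / rad t - l * rad t) * (x t - phi l t)) (at t)" for t
    by (rule derivative_eq_intros y refl)+ (simp add: algebra_simps)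
  ultimately have "x t - phi l t = 0 \<and> y t - chi l t = 0"
    by (rule linear_system_unique_zero[where s = s, OF _ _ abs_inverse_rad_le abs_potential_le])
      (simp_all add: s)
  then show ?thesis by simp
qed

lemma phi_chi_no_common_zero: "phi l t \<noteq> 0 \<or> chi l t \<noteq> 0"
proof (rule ccontr)
  assume "\<not> ?thesis"
  then have "phi l 0 = 0 \<and> chi l 0 = 0"
    by (intro linear_system_unique_zero[where s = t, OF DERIV_phi DERIV_chi abs_inverse_rad_le abs_potential_le]) auto
  then show False by simp
qed

lemma phi_even: "phi l (- t) = phi l t" and chi_odd: "chi l (- t) = - chi l t"
proof -
  have "((\<lambda>t. phi l (- t)) has_real_derivative 1 / rad t * - chi l (- t)) (at t)" for t
    by (rule derivative_eq_intros refl)+ simp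
  moreover have "((\<lambda>t. - chi l (- t)) has_real_derivative (1 / rad t - l * rad t) * phi l (- t)) (at t)" for t
    by (rule derivative_eq_intros refl)+ simp
  ultimately have "phi l (- t) = phi l t \<and> - chi l (- t) = chi l t"
    by (rule mode_unique[where s = 0]) auto
  then show "phi l (- t) = phi l t" "chi l (- t) = - chi l t" by auto
qed

text \<open>\<open>rad\<close> is symmetric about pi, and a zero of \<open>chi\<close> at pi makes
  \<open>phi\<close> agree with its mirror image there. The reflections in 0 and in pi compose to
  the translation by 2 pi.\<close>

lemma phi_periodic:
  assumes "chi l pi = 0"
  shows "phi l (t + 2 * pi) = phi l t"
proof -
  have "((\<lambda>t. phi l (2 * pi - t)) has_real_derivative 1 / rad t * - chi l (2 * pi - t)) (at t)" for t
    by (rule derivative_eq_intros refl)+ simp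
  moreover have "((\<lambda>t. - chi l (2 * pi - t)) has_real_derivative (1 / rad t - l * rad t) * phi l (2 * pi - t)) (at t)" for t
    by (rule derivative_eq_intros refl)+ simp
  ultimately have "phi l (2 * pi - - t) = phi l (- t) \<and> - chi l (2 * pi - - t) = chi l (- t)"
    by (rule mode_unique[where s = pi]) (auto simp: assms)
  then show ?thesis by (simp add: phi_even add.commute)
qed

lemma periodic_int_shift:
  fixes f :: "real \<Rightarrow> 'a"
  assumes per: "\<And>t. f (t + 2 * pi) = f t"
  shows "f (t + 2 * pi * of_int n) = f t"
proof -
  have nat: "f (t + 2 * pi * of_nat n) = f t" for n t
  proof (induction n)
    case (Suc n)
    have "t + 2 * pi * of_nat (Suc n) = (t + 2 * pi * of_nat n) + 2 * pi" by (simp add: algebra_simps)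
    then show ?case using per[of "t + 2 * pi * of_nat n"] Suc by (simp only:)
  qed simp
  show ?thesis
  proof (cases n)
    case (nonneg m)
    then show ?thesis using nat by simp
  next
    case (neg m)
    have "t + 2 * pi * of_int n + 2 * pi * of_nat (Suc m) = t"
      unfolding neg by (simp add: algebra_simps)
    then show ?thesis using nat[of "t + 2 * pi * of_int n" "Suc m"] by (simp only:)
  qed
qed

lemma periodic_representative:
  fixes f :: "real \<Rightarrow> 'a"
  assumes per: "\<And>t. f (t + 2 * pi) = f t"
  obtains s where "s \<in> {-pi..pi}" "f s = f t"
proof
  define n where "n = \<lfloor>(t + pi) / (2 * pi)\<rfloor>"
  have "of_int n \<le> (t + pi) / (2 * pi)" "(t + pi) / (2 * pi) < of_int n + 1"
    unfolding n_def by linarith+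
  then have "of_int n * (2 * pi) \<le> t + pi" "t + pi < (of_int n + 1) * (2 * pi)"
    by (simp_all add: le_divide_eq divide_less_eq)
  then show "t + 2 * pi * of_int (- n) \<in> {-pi..pi}" by (simp add: algebra_simps)
  show "f (t + 2 * pi * of_int (- n)) = f t" by (rule periodic_int_shift) (rule per)
qed

section \<open>Dependence on l and the critical parameter\<close>

lemma phi_chi_continuous_parameter:
  assumes "0 < e"
  shows "\<exists>d>0. \<forall>l'. \<bar>l' - l\<bar> < d \<longrightarrow>
           (\<forall>t\<in>{0..pi}. \<bar>phi l t - phi l' t\<bar> < e \<and> \<bar>chi l t - chi l' t\<bar> < e)"
proof -
  have "compact (phi l ` {0..pi})"
    by (intro compact_continuous_image continuous_on_phi) simp
  then obtain B where B: "\<And>t. t \<in> {0..pi} \<Longrightarrow> \<bar>phi l t\<bar> \<le> B"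
    using compact_imp_bounded bounded_iff by (metis imageI real_norm_def)
  then have B0: "0 \<le> B" using B[of 0] by simp
  \<comment> \<open>This bounds the coefficients for all parameters within distance 1 of
    \<open>l\<close>, hence the cap 1 in \<open>d\<close>; \<open>k\<close> below is then a
    Lipschitz constant in the parameter.\<close>
  define M where "M = 5/2 + (\<bar>l\<bar> + 1) * (5/2)"
  define k where "k = 5/2 * B * sqrt (exp ((2 * M + 1) * pi))"
  have k0: "0 \<le> k" using B0 by (simp add: k_def)
  define d where "d = min 1 (e / (k + 1))"
  have "0 < d" using assms k0 by (simp add: d_def)
  moreover have "\<bar>phi l t - phi l' t\<bar> < e \<and> \<bar>chi l t - chi l' t\<bar> < e"
    if l': "\<bar>l' - l\<bar> < d" and t: "t \<in> {0..pi}" for l' t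
  proof -
    have le: "5/2 + \<bar>l'\<bar> * (5/2) \<le> M" 
    proof -
      have "\<bar>l'\<bar> \<le> \<bar>l\<bar> + 1" using l' unfolding d_def by linarith
      then show ?thesis by (simp add: M_def)
    qed
    have "(phi l t - phi l' t)\<^sup>2 + (chi l t - chi l' t)\<^sup>2 \<le> (\<bar>l' - l\<bar> * (5/2) * B)\<^sup>2 * exp ((2 * M + 1) * pi)"
    proof (rule linear_system_perturb[OF DERIV_phi DERIV_chi DERIV_phi DERIV_chi _ _ B _ _ _ t])
      show "\<bar>1 / rad t\<bar> \<le> M" "\<bar>1 / rad t - l' * rad t\<bar> \<le> M" for t
        using abs_inverse_rad_le[of t l'] abs_potential_le[of t l'] le by linarith+
      show "\<bar>1 / rad t - l * rad t - (1 / rad t - l' * rad t)\<bar> \<le> \<bar>l' - l\<bar> * (5 / 2)" for t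
      proof -
        have "1 / rad t - l * rad t - (1 / rad t - l' * rad t) = (l' - l) * rad t"
          by (simp add: algebra_simps)
        then show ?thesis
          using mult_left_mono[of "\<bar>rad t\<bar>" "5/2" "\<bar>l' - l\<bar>"] rad_bounds[of t] by (simp add: abs_mult)
      qed
    qed simp_all
    also have "\<dots> = (k * \<bar>l' - l\<bar>)\<^sup>2"
      unfolding k_def power_mult_distrib by simp
    finally have s: "(phi l t - phi l' t)\<^sup>2 + (chi l t - chi l' t)\<^sup>2 \<le> (k * \<bar>l' - l\<bar>)\<^sup>2" .
    have "(phi l t - phi l' t)\<^sup>2 \<le> (k * \<bar>l' - l\<bar>)\<^sup>2" "(chi l t - chi l' t)\<^sup>2 \<le> (k * \<bar>l' - l\<bar>)\<^sup>2"
      using s zero_le_power2[of "phi l t - phi l' t"] zero_le_power2[of "chi l t - chi l' t"] by linarith+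
    then have "\<bar>phi l t - phi l' t\<bar> \<le> k * \<bar>l' - l\<bar>" "\<bar>chi l t - chi l' t\<bar> \<le> k * \<bar>l' - l\<bar>"
      using k0 by (simp_all add: abs_le_square_iff[symmetric])
    moreover have "k * \<bar>l' - l\<bar> < e"
    proof -
      have "k * \<bar>l' - l\<bar> \<le> k * (e / (k + 1))"
        using l' k0 by (intro mult_left_mono) (auto simp: d_def)
      also have "\<dots> < e" using k0 assms by (simp add: field_simps)
      finally show ?thesis .
    qed
    ultimately show ?thesis by linarith
  qed
  ultimately show ?thesis by blast
qed

text \<open>The condition that makes the even solution on [-pi, pi], continued with period 2 pi, a
  positive supersolution: since \<open>chi\<close> is odd, \<open>chi l pi > 0\<close> makes the
  slope drop at the corner v = pi, which is the direction a supersolution allows.\<close>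

definition subcritical :: "real \<Rightarrow> bool" where
  "subcritical l \<longleftrightarrow> (\<forall>t\<in>{0..pi}. 0 < phi l t) \<and> 0 < chi l pi"

text \<open>For l = 0 the product phi chi has derivative (phi^2 + chi^2)/r > 0 and starts at 0. It
  is therefore positive for t > 0, so phi^2 never falls below its initial value 1 and
  \<open>phi\<close> cannot change sign.\<close>

lemma subcritical_0: "subcritical 0"
proof -
  define E where "E t = phi 0 t * chi 0 t" for t
  have dE: "(E has_real_derivative ((phi 0 t)\<^sup>2 + (chi 0 t)\<^sup>2) / rad t) (at t)" for t
    unfolding E_def
    by (rule derivative_eq_intros refl)+ (simp add: power2_eq_square add_divide_distrib)
  have pos: "0 < ((phi 0 t)\<^sup>2 + (chi 0 t)\<^sup>2) / rad t" for t
    using phi_chi_no_common_zero[of 0 t] by (auto simp: sum_power2_gt_zero_iff)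
  have E_inc: "E s < E t" if "s < t" for s t
    using that dE pos by (intro DERIV_pos_imp_increasing[of s t E]) blast+
  have E0: "E 0 = 0" by (simp add: E_def)
  have dp: "((\<lambda>t. (phi 0 t)\<^sup>2) has_real_derivative 2 * E t / rad t) (at t)" for t
    by (rule derivative_eq_intros refl)+ (simp add: E_def)
  have sq: "1 \<le> (phi 0 t)\<^sup>2" if "0 \<le> t" for t
  proof -
    have "(phi 0 0)\<^sup>2 \<le> (phi 0 t)\<^sup>2"
    proof (rule DERIV_nonneg_imp_nondecreasing[OF that])
      fix s :: real assume "0 \<le> s"
      then have "0 \<le> E s" using E_inc[of 0 s] E0 by (cases "s = 0") auto
      then show "\<exists>y. ((\<lambda>t. (phi 0 t)\<^sup>2) has_real_derivative y) (at s) \<and> 0 \<le> y"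
        using dp[of s] rad_pos(1)[of s] by (intro exI[of _ "2 * E s / rad s"]) auto
    qed
    then show ?thesis by simp
  qed
  have p: "0 < phi 0 t" if "0 \<le> t" for t
  proof (rule ccontr)
    assume "\<not> 0 < phi 0 t"
    then obtain s where "0 \<le> s" "phi 0 s = 0"
      using IVT2'[of "phi 0" t 0 0, OF _ _ \<open>0 \<le> t\<close> continuous_on_phi] by auto
    then show False using sq[of s] by simp
  qed
  moreover have "0 < chi 0 pi"
    using E_inc[of 0 pi] E0 p[of pi] by (auto simp: E_def zero_less_mult_iff)
  ultimately show ?thesis by (auto simp: subcritical_def)
qed

text \<open>A positive continuous function on the compact interval [0, pi] has a positive minimum,
  which leaves room for a uniformly small perturbation.\<close>

lemma subcritical_open:
  assumes "subcritical l"
  shows "\<exists>d>0. \<forall>l'. \<bar>l' - l\<bar> < d \<longrightarrow> subcritical l'"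
proof -
  obtain m where m: "m \<in> {0..pi}" "\<And>t. t \<in> {0..pi} \<Longrightarrow> phi l m \<le> phi l t"
    using continuous_attains_inf[of "{0..pi}" "phi l"] continuous_on_phi by auto
  define e where "e = min (phi l m) (chi l pi)"
  have "0 < e" using assms m by (auto simp: e_def subcritical_def)
  then obtain d where d: "d > 0" "\<And>l' t. \<bar>l' - l\<bar> < d \<Longrightarrow> t \<in> {0..pi} \<Longrightarrow>
      \<bar>phi l t - phi l' t\<bar> < e \<and> \<bar>chi l t - chi l' t\<bar> < e"
    using phi_chi_continuous_parameter by meson
  have "subcritical l'" if l': "\<bar>l' - l\<bar> < d" for l'
  proof -
    have "0 < phi l' t" if "t \<in> {0..pi}" for t
      using d(2)[OF l' that] m(2)[OF that] by (auto simp: e_def)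
    moreover have "0 < chi l' pi"
      using d(2)[OF l', of pi] by (auto simp: e_def)
    ultimately show ?thesis by (simp add: subcritical_def)
  qed
  then show ?thesis using d by blast
qed

text \<open>Picone's identity against the test function \<open>r\<close> (the coordinate function \<open>x\<close>), whose Rayleigh
  quotient is exactly \<open>3/7\<close>: \<open>E\<close> is the antiderivative of \<open>r r'\<^sup>2 + r - 3/7 r\<^sup>3\<close>.\<close>

lemma not_subcritical_3_7: "\<not> subcritical (3/7)"
proof
  assume g: "subcritical (3/7)"
  define w where "w t = chi (3/7) t / phi (3/7) t" for t
  define E where "E v = sqrt 2 * (v / 2 - sin v * cos v / 2) + sin v ^ 3 / 3 + sqrt 2 * v + sin v
     - 3/7 * (2 * sqrt 2 * v + 6 * sin v + 3 * sqrt 2 * (v / 2 + sin v * cos v / 2) + sin v - sin v ^ 3 / 3)" for v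
  have dE: "(E has_real_derivative rad v * (sin v)\<^sup>2 + rad v - 3/7 * rad v ^ 3) (at v)" for v
  proof -
    define c where "c = cos v"
    define s where "s = sin v"
    have s2: "s\<^sup>2 = 1 - c\<^sup>2" unfolding s_def c_def by (simp add: sin_squared_eq)
    have q2: "sqrt 2 ^ 2 = (2::real)" "sqrt 2 ^ 3 = 2 * sqrt (2::real)" by (simp_all add: power3_eq_cube)
    have d: "(E has_real_derivative sqrt 2 * (1/2 - (c * c - s * s) / 2) + s\<^sup>2 * c + sqrt 2 + c
      - 3/7 * (2 * sqrt 2 + 6 * c + 3 * sqrt 2 * (1/2 + (c * c - s * s) / 2) + c - s\<^sup>2 * c)) (at v)"
      unfolding E_def c_def s_def
      by (auto intro!: derivative_eq_intros simp: power2_eq_square algebra_simps add_divide_distrib diff_divide_distrib)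
    have "sqrt 2 * (1/2 - (c * c - s * s) / 2) + s\<^sup>2 * c + sqrt 2 + c
      - 3/7 * (2 * sqrt 2 + 6 * c + 3 * sqrt 2 * (1/2 + (c * c - s * s) / 2) + c - s\<^sup>2 * c)
      = (sqrt 2 + c) * s\<^sup>2 + (sqrt 2 + c) - 3/7 * (sqrt 2 + c) ^ 3"
      using s2 q2(1) by algebra
    then show ?thesis
      by (intro field_derivative_eqI[OF d]) (simp add: rad_def c_def s_def)
  qed
  have dw: "((\<lambda>t. (rad t)\<^sup>2 * w t) has_real_derivative
     - 2 * rad t * sin t * w t + rad t - 3/7 * rad t ^ 3 - rad t * (w t)\<^sup>2) (at t)" if "t \<in> {0..pi}" for t
  proof -
    have "0 < phi (3/7) t" using g that unfolding subcritical_def by blast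
    then have nz: "phi (3/7) t \<noteq> 0" by simp
    show ?thesis unfolding w_def
      by (rule derivative_eq_intros refl nz)+ (use nz in \<open>simp add: field_simps power2_eq_square power3_eq_cube\<close>)
  qed
  \<comment> \<open>Here w solves the Riccati equation w' = 1/r - (3/7) r - w^2/r, and r' = - sin,
    so the derivative of E - r^2 w collapses to r (sin + w)^2.\<close>
  have "E 0 - (rad 0)\<^sup>2 * w 0 \<le> E pi - (rad pi)\<^sup>2 * w pi"
  proof (rule DERIV_nonneg_imp_nondecreasing[of 0 pi "\<lambda>t. E t - (rad t)\<^sup>2 * w t"])
    fix t :: real assume "0 \<le> t" "t \<le> pi"
    then have "((\<lambda>t. E t - (rad t)\<^sup>2 * w t) has_real_derivative rad t * (sin t + w t)\<^sup>2) (at t)"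
      by (intro field_derivative_eqI[OF DERIV_diff[OF dE dw]]) (auto simp: power2_eq_square algebra_simps)
    then show "\<exists>y. ((\<lambda>t. E t - (rad t)\<^sup>2 * w t) has_real_derivative y) (at t) \<and> 0 \<le> y"
      by (intro exI[of _ "rad t * (sin t + w t)\<^sup>2"]) auto
  qed simp
  \<comment> \<open>\<open>E pi = 0\<close> says that 3/7 is exactly the Rayleigh quotient of r.
    Monotonicity then forces (rad pi)^2 w(pi) <= 0, against \<open>chi > 0\<close> at pi.\<close>
  moreover have "E 0 = 0" "E pi = 0" "w 0 = 0" by (simp_all add: E_def w_def algebra_simps)
  moreover have "0 < (rad pi)\<^sup>2 * w pi" using g by (simp add: subcritical_def w_def)
  ultimately show False by simp
qed

text \<open>L is the supremum of the initial stretch of subcritical parameters. Openness shows that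
  L itself is not subcritical, while passing to the limit keeps the weak inequalities. Strict
  positivity of \<open>phi\<close> cannot be what fails, because a zero that is also a minimum would
  be a common zero of \<open>phi\<close> and \<open>chi\<close>; so it is \<open>chi\<close> that
  vanishes at pi.\<close>

lemma critical_parameter_exists:
  obtains l where "0 < l" "l \<le> 3/7" "chi l pi = 0" "\<And>l'. 0 \<le> l' \<Longrightarrow> l' < l \<Longrightarrow> subcritical l'"
proof -
  define A where "A = {l. 0 \<le> l \<and> (\<forall>l'. 0 \<le> l' \<and> l' \<le> l \<longrightarrow> subcritical l')}"
  have A0: "0 \<in> A" using subcritical_0 by (auto simp: A_def)
  have Aub: "l \<le> 3/7" if "l \<in> A" for l
    using that not_subcritical_3_7 by (auto simp: A_def intro: ccontr)
  then have bdd: "bdd_above A" by (rule bdd_aboveI)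
  define L where "L = Sup A"
  have L1: "l \<le> L" if "l \<in> A" for l using cSup_upper[OF that bdd] by (simp add: L_def)
  have L37: "L \<le> 3/7" unfolding L_def using A0 Aub by (intro cSup_least) auto
  have below: "subcritical l'" if "0 \<le> l'" "l' < L" for l'
  proof -
    obtain a where "a \<in> A" "l' < a" using \<open>l' < L\<close> A0 less_cSup_iff[OF _ bdd] unfolding L_def by auto
    then show ?thesis using that by (auto simp: A_def)
  qed
  have ext: "False" if gL: "subcritical L"
  proof -
    obtain d where d: "d > 0" "\<And>l'. \<bar>l' - L\<bar> < d \<Longrightarrow> subcritical l'" using subcritical_open[OF gL] by blast
    have "subcritical l'" if "0 \<le> l'" "l' \<le> L + d / 2" for l'
    proof (cases "l' < L")
      case True then show ?thesis using below that by simp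
    next
      case False then show ?thesis using d(1) that by (intro d(2)) auto
    qed
    then have "L + d / 2 \<in> A" using L1[OF A0] d(1) by (auto simp: A_def)
    then show False using L1[of "L + d/2"] d(1) by simp
  qed
  have Lpos: "0 < L" using L1[OF A0] ext subcritical_0 by (cases "L = 0") auto
  \<comment> \<open>Weak inequalities pass to the limit from parameters below L, by uniform
    continuity in the parameter.\<close>
  have lim: "0 \<le> phi L t \<and> 0 \<le> chi L pi" if t: "t \<in> {0..pi}" for t
  proof (rule ccontr)
    assume a: "\<not> ?thesis"
    define e where "e = max (- phi L t) (- chi L pi)"
    have "0 < e" using a by (auto simp: e_def)
    then obtain d where d: "d > 0" "\<And>l' t. \<bar>l' - L\<bar> < d \<Longrightarrow> t \<in> {0..pi} \<Longrightarrow>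
        \<bar>phi L t - phi l' t\<bar> < e \<and> \<bar>chi L t - chi l' t\<bar> < e"
      using phi_chi_continuous_parameter by meson
    define l' where "l' = max 0 (L - d / 2)"
    have l': "0 \<le> l'" "l' < L" "\<bar>l' - L\<bar> < d" using Lpos d(1) by (auto simp: l'_def)
    then have "0 < phi l' t" "0 < chi l' pi" using below[of l'] t by (auto simp: subcritical_def)
    then show False using d(2)[OF l'(3) t] d(2)[OF l'(3), of pi] a by (auto simp: e_def)
  qed
  have "chi L pi = 0"
  proof (rule ccontr)
    assume "chi L pi \<noteq> 0"
    then have cpos: "0 < chi L pi" using lim[of 0] by auto
    have "0 < phi L t" if t: "t \<in> {0..pi}" for t
    proof (rule ccontr)
      assume "\<not> 0 < phi L t"
      then have z: "phi L t = 0" using lim[OF t] by auto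
      then have t0: "0 < t" using t by (cases "t = 0") auto
      show False
      proof (cases "t = pi")
        case True
        \<comment> \<open>A zero at the end point pi with positive slope would make
          \<open>phi\<close> negative just to its left.\<close>
        have "0 < 1 / rad pi * chi L pi" using cpos by simp
        then obtain d where d: "d > 0" "\<And>h. 0 < h \<Longrightarrow> h < d \<Longrightarrow> phi L (pi - h) < phi L pi"
          using DERIV_pos_inc_left[OF DERIV_phi[of L pi]] by blast
        have "phi L (pi - min pi d / 2) < phi L pi" using d(1) by (intro d(2)) auto
        moreover have "0 \<le> phi L (pi - min pi d / 2)"
          using d(1) lim[of "pi - min pi d / 2"] pi_gt_zero by (auto simp: min_def)
        ultimately show False using z True by simp
      next
        case False
        then have "t < pi" using t by auto
        have "1 / rad t * chi L t = 0"
        proof (rule DERIV_local_min[OF DERIV_phi])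
          show "0 < min t (pi - t)" using t0 \<open>t < pi\<close> by simp
          show "\<forall>y. \<bar>t - y\<bar> < min t (pi - t) \<longrightarrow> phi L t \<le> phi L y"
            using lim z by (auto simp: abs_less_iff)
        qed
        then show False using z phi_chi_no_common_zero[of L t] by simp
      qed
    qed
    then have "subcritical L" using cpos by (simp add: subcritical_def)
    then show False by (rule ext)
  qed
  then show thesis using that Lpos L37 below by blast
qed

section \<open>Comparison arguments on an interval\<close>

text \<open>The equality case of every Picone argument below: a nondecreasing quantity without net
  growth is constant, so the squares that make up its derivative vanish pointwise.\<close>

lemma nonneg_derivative_eq_zero:
  fixes G :: "real \<Rightarrow> real"
  assumes d: "\<And>t. t \<in> {a..b} \<Longrightarrow> (G has_real_derivative G' t) (at t within {a..b})"
    and nonneg: "\<And>t. t \<in> {a..b} \<Longrightarrow> 0 \<le> G' t" and le: "G b \<le> G a" and t: "t \<in> {a<..<b}"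
  shows "G' t = 0" "s \<in> {a..b} \<Longrightarrow> G s = G a"
proof -
  have cont: "continuous_on {a..b} G"
    unfolding continuous_on_eq_continuous_within using DERIV_continuous[OF d] by blast
  have mono: "G x \<le> G y" if "a \<le> x" "x \<le> y" "y \<le> b" for x y
  proof (rule DERIV_nonneg_imp_increasing_open[OF that(2)])
    show "continuous_on {x..y} G" using cont that by (auto intro: continuous_on_subset)
    fix z assume "x < z" "z < y"
    then have "z \<in> {a..b}" "(G has_real_derivative G' z) (at z)"
      using that d[of z] at_within_Icc_at[of a z b] by simp_all
    then show "\<exists>y. (G has_real_derivative y) (at z) \<and> 0 \<le> y" using nonneg by blast
  qed
  have const: "G s = G a" if "s \<in> {a..b}" for s
  proof -
    have "G a \<le> G s" "G s \<le> G b" using that by (auto intro!: mono)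
    then show ?thesis using le by linarith
  qed
  then show "s \<in> {a..b} \<Longrightarrow> G s = G a" .
  have "(G has_real_derivative G' t) (at t)" using d[of t] t at_within_Icc_at[of a t b] by simp
  moreover have "(G has_real_derivative 0) (at t)"
  proof (rule has_field_derivative_transform_within_open[of "\<lambda>_. G a" 0 t "{a<..<b}" G])
    show "G a = G x" if "x \<in> {a<..<b}" for x using const[of x] that by simp
  qed (use t in auto)
  ultimately show "G' t = 0" by (rule DERIV_unique)
qed

lemma derivative_of_locally_zero:
  fixes f :: "real \<Rightarrow> real"
  assumes "(f has_real_derivative D) (at t)" "t \<in> {a<..<b}" "\<And>s. s \<in> {a<..<b} \<Longrightarrow> f s = 0"
  shows "D = 0"
proof -
  have "(f has_real_derivative 0) (at t)"
    by (rule has_field_derivative_transform_within_open[of "\<lambda>_. 0" 0 t "{a<..<b}" f])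
      (use assms in auto)
  with assms(1) show ?thesis by (rule DERIV_unique)
qed

text \<open>The Riccati comparison function \<open>w = \<nu> p cot \<eta>\<close> comes from the Pruefer angle of the equation:
  since the logarithmic derivative of \<open>p\<close> is at most \<open>sin t / r\<close>, that angle grows no faster than
  \<open>\<eta>\<close>, and \<open>\<eta>\<close> grows by less than \<open>\<pi>\<close> on the interval.\<close>

lemma dirichlet_solution_vanishes:
  fixes a b p p' :: "real \<Rightarrow> real"
  assumes p: "\<And>t. 0 < p t" "\<And>t. (p has_real_derivative p' t) (at t)"
    and p': "\<And>t. t \<in> {0..pi} \<Longrightarrow> \<bar>p' t\<bar> \<le> sin t / rad t * p t"
    and a: "\<And>t. (a has_real_derivative b t / p t) (at t)"
    and b: "\<And>t. (b has_real_derivative - (nu\<^sup>2 * p t * a t)) (at t)"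
    and nu: "0 < nu" "nu < 2/3" and bc: "a 0 = 0" "a pi = 0" and t: "t \<in> {0<..<pi}"
  shows "a t = 0"
proof -
  \<comment> \<open>Half of the slack. On [0, pi] the angle \<open>eta\<close> grows by at most 2
    pi/3 + 1, so starting at \<open>d\<close> it stays strictly between 0 and pi and the cotangent
    never becomes singular.\<close>
  define d where "d = (pi / 3 - 1) / 2"
  have d0: "0 < d" using pi_gt3 by (simp add: d_def)
  \<comment> \<open>The logarithm integrates sin t / (2 r). Since 2/5 <= r <= 5/2 and 5/2 <= e, both
    logarithms have absolute value at most 1.\<close>
  define eta where "eta t = d + 2/3 * t + (ln (rad 0) - ln (rad t)) / 2" for t
  have deta: "(eta has_real_derivative 2/3 + sin t / (2 * rad t)) (at t)" for t
    unfolding eta_def by (auto intro!: derivative_eq_intros simp: field_simps)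
  have eta: "0 < eta t" "eta t < pi" if t: "t \<in> {0..pi}" for t
  proof -
    have "rad t \<le> rad 0" by (simp add: rad_def)
    then have "ln (rad t) \<le> ln (rad 0)" by simp
    then show "0 < eta t" using t d0 unfolding eta_def by (auto intro!: add_pos_nonneg)
    have "5/2 \<le> exp (1::real)"
      using exp_lower_Taylor_quadratic[of "1::real"] by simp
    then have "ln (5/2) \<le> ln (exp (1::real))" by (subst ln_le_cancel_iff) auto
    then have "ln (5/2) \<le> (1::real)" by simp
    have "ln (rad 0) \<le> ln (5/2)" "ln (2/5) \<le> ln (rad t)"
      using rad_bounds(2)[of 0] rad_bounds(1)[of t] by (subst ln_le_cancel_iff; simp)+
    moreover have "ln (2/5) = - ln (5/2::real)" using ln_inverse[of "5/2::real"] by simp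
    ultimately have "ln (rad 0) \<le> 1" "- ln (rad t) \<le> 1"
      using \<open>ln (5/2) \<le> (1::real)\<close> by (metis order_trans, metis order_trans minus_le_iff)
    then have "(ln (rad 0) - ln (rad t)) / 2 \<le> 1" by simp
    moreover have "2/3 * t \<le> 2/3 * pi" using t by simp
    ultimately show "eta t < pi" using d0 unfolding eta_def d_def by (simp add: field_simps)
  qed
  have s0: "0 < sin (eta t)" if "t \<in> {0..pi}" for t
    using eta[OF that] by (simp add: sin_gt_zero)
  define w where "w t = nu * p t * (cos (eta t) / sin (eta t))" for t
  define w' where "w' t = nu * p' t * (cos (eta t) / sin (eta t))
      - nu * p t * (2/3 + sin t / (2 * rad t)) / (sin (eta t))\<^sup>2" for t
  have dw: "(w has_real_derivative w' t) (at t)" if "t \<in> {0..pi}" for t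
  proof -
    have n: "sin (eta t) \<noteq> 0" using s0[OF that] by simp
    have "((\<lambda>t. cot (eta t)) has_real_derivative
        - inverse ((sin (eta t))\<^sup>2) * (2/3 + sin t / (2 * rad t))) (at t)"
      by (rule DERIV_chain2[OF DERIV_cot[OF n] deta])
    then have dcot: "((\<lambda>t. cos (eta t) / sin (eta t)) has_real_derivative
        - inverse ((sin (eta t))\<^sup>2) * (2/3 + sin t / (2 * rad t))) (at t)"
      by (simp add: cot_def)
    have "(w has_real_derivative nu * p' t * (cos (eta t) / sin (eta t))
        + - inverse ((sin (eta t))\<^sup>2) * (2/3 + sin t / (2 * rad t)) * (nu * p t)) (at t)"
      unfolding w_def by (rule DERIV_mult[OF DERIV_cmult[OF p(2)] dcot])
    then show ?thesis by (rule field_derivative_eqI) (unfold w'_def divide_inverse, algebra)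
  qed
  \<comment> \<open>The defect of \<open>w\<close> in the Riccati equation w' = - w^2/p - nu^2 p of
    the actual solution; \<open>K > 0\<close> says that \<open>w\<close> is a strict
    supersolution.\<close>
  define K where "K t = - (w' t + (w t)\<^sup>2 / p t + nu\<^sup>2 * p t)" for t
  have K: "0 < K t" if t: "t \<in> {0..pi}" for t
  proof -
    define s c where "s = sin (eta t)" and "c = cos (eta t)"
    have s: "0 < s" using s0[OF t] by (simp add: s_def)
    have sc: "s\<^sup>2 + c\<^sup>2 = 1" by (simp add: s_def c_def)
    have eq: "K t = nu / s\<^sup>2 * (p t * (2/3 + sin t / (2 * rad t)) - nu * p t - p' t * (s * c))"
    proof -
      have "(w t)\<^sup>2 = nu\<^sup>2 * (p t)\<^sup>2 * (c\<^sup>2 / s\<^sup>2)"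
        by (simp add: w_def s_def c_def power_mult_distrib power_divide)
      then have "(w t)\<^sup>2 / p t + nu\<^sup>2 * p t = nu\<^sup>2 * p t * (s\<^sup>2 + c\<^sup>2) / s\<^sup>2"
        using p(1)[of t] s by (simp add: field_simps power2_eq_square)
      then have "(w t)\<^sup>2 / p t + nu\<^sup>2 * p t = nu\<^sup>2 * p t / s\<^sup>2" by (simp add: sc)
      then have "K t = - (w' t + nu\<^sup>2 * p t / s\<^sup>2)" by (simp add: K_def algebra_simps)
      also have "\<dots> = nu / s\<^sup>2 * (p t * (2/3 + sin t / (2 * rad t)) - nu * p t - p' t * (s * c))"
        using s unfolding w'_def s_def[symmetric] c_def[symmetric]
        by (simp add: field_simps power2_eq_square)
      finally show ?thesis .
    qed
    \<comment> \<open>This is where the factor 2 in sin t / (2 r) comes from: p'/p enters the angle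
      equation multiplied by sin times cos. The gap between \<open>nu\<close> and 2/3 makes the
      inequality strict.\<close>
    have "\<bar>s * c\<bar> \<le> 1/2"
    proof -
      have "2 * \<bar>s * c\<bar> \<le> s\<^sup>2 + c\<^sup>2"
        using zero_le_power2[of "\<bar>s\<bar> - \<bar>c\<bar>"] by (simp add: power2_diff abs_mult)
      then show ?thesis using sc by simp
    qed
    then have "\<bar>p' t\<bar> * \<bar>s * c\<bar> \<le> (sin t / rad t * p t) * (1/2)"
      using p'[OF t] by (intro mult_mono) auto
    then have "p' t * (s * c) \<le> p t * (sin t / (2 * rad t))"
      using abs_ge_self[of "p' t * (s * c)"] by (simp add: abs_mult mult.commute)
    moreover have "nu * p t < 2/3 * p t" using nu p(1)[of t] by simp
    ultimately have "0 < p t * (2/3 + sin t / (2 * rad t)) - nu * p t - p' t * (s * c)"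
      by (simp add: algebra_simps)
    then show ?thesis unfolding eq using nu s by simp
  qed
  \<comment> \<open>The Picone quantity: its derivative is a square plus a^2 K, and the Dirichlet
    conditions make it vanish at both ends.\<close>
  define G where "G t = a t * b t - (a t)\<^sup>2 * w t" for t
  have dG: "(G has_real_derivative (b t - a t * w t)\<^sup>2 / p t + (a t)\<^sup>2 * K t) (at t)"
    if t: "t \<in> {0..pi}" for t
  proof -
    have "(G has_real_derivative (b t / p t) * b t + (- (nu\<^sup>2 * p t * a t)) * a t
        - (2 * a t * (b t / p t) * w t + (a t)\<^sup>2 * w' t)) (at t)"
      unfolding G_def by (rule derivative_eq_intros a b dw t refl)+ (simp add: algebra_simps)
    then show ?thesis
      by (rule field_derivative_eqI) (unfold K_def divide_inverse, algebra)
  qed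
  have "(b t - a t * w t)\<^sup>2 / p t + (a t)\<^sup>2 * K t = 0"
  proof (rule nonneg_derivative_eq_zero(1)[OF has_field_derivative_at_within[OF dG] _ _ t])
    show "0 \<le> (b t - a t * w t)\<^sup>2 / p t + (a t)\<^sup>2 * K t" if "t \<in> {0..pi}" for t
      using K[OF that] p(1)[of t] by simp
  qed (auto simp: G_def bc)
  moreover have "0 \<le> (b t - a t * w t)\<^sup>2 / p t" using p(1)[of t] by simp
  moreover have tK: "0 < K t" using K t by simp
  ultimately have "(a t)\<^sup>2 * K t \<le> 0" by linarith
  then show "a t = 0" using tK by (auto simp: mult_le_0_iff)
qed

text \<open>Rotationally symmetric eigenfunctions: the odd part of \<open>a\<close> and \<open>r\<close> times the derivative of its
  even part both vanish at \<open>0\<close> and \<open>\<pi>\<close>, and solve equations dual to each other under \<open>r \<mapsto> 1/r\<close>.\<close>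

lemma periodic_radial_solution_vanishes:
  fixes a a1 a2 :: "real \<Rightarrow> real"
  assumes da: "\<And>t. (a has_real_derivative a1 t) (at t)" and da1: "\<And>t. (a1 has_real_derivative a2 t) (at t)"
    and ode: "\<And>t. a2 t - sin t / rad t * a1 t + l * a t = 0"
    and per: "\<And>t. a (t + 2 * pi) = a t" and l: "0 < l" "l < 4/9"
  shows "a t = 0"
proof -
  define nu where "nu = sqrt l"
  have nu: "0 < nu" "nu < 2/3" "nu\<^sup>2 = l"
  proof -
    show "nu < 2/3" unfolding nu_def using l by (intro real_less_lsqrt) (auto simp: power2_eq_square)
  qed (use l in \<open>auto simp: nu_def\<close>)
  have per1: "a1 (t + 2 * pi) = a1 t" for t
  proof -
    have "((\<lambda>t. a (t + 2 * pi)) has_real_derivative a1 (t + 2 * pi)) (at t)"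
      using da[of "t + 2 * pi"] by (simp add: DERIV_shift)
    then show ?thesis using da[of t] by (simp add: per DERIV_unique)
  qed
  have pp: "a (- pi) = a pi" "a1 (- pi) = a1 pi" using per[of "- pi"] per1[of "- pi"] by simp_all
  have a2: "a2 t = sin t / rad t * a1 t - l * a t" for t using ode[of t] by simp
  have dam: "((\<lambda>t. a (- t)) has_real_derivative - a1 (- t)) (at t)"
    and da1m: "((\<lambda>t. a1 (- t)) has_real_derivative - a2 (- t)) (at t)" for t
    using da[of "- t"] da1[of "- t"] by (simp_all add: DERIV_mirror)
  have drad: "(rad has_real_derivative - sin t) (at t)" for t
    using DERIV_rad[OF DERIV_ident, of t] by simp
  define A where "A t = a t - a (- t)" for t
  define b where "b t = rad t * (a1 t - a1 (- t))" for t
  have dA: "(A has_real_derivative rad t * (a1 t + a1 (- t)) / rad t) (at t)" for t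
    unfolding A_def by (rule derivative_eq_intros da dam refl)+ simp
  \<comment> \<open>Division by \<open>1 / rad t\<close> puts the equation into the form flux over
    weight, with the weight p = 1/r in place of r.\<close>
  have db: "(b has_real_derivative - l * (a t + a (- t)) / (1 / rad t)) (at t)" for t
    unfolding b_def by (rule derivative_eq_intros da1 da1m refl)+ (simp add: a2 field_simps)
  have A0: "A t = 0" if "t \<in> {0<..<pi}" for t
  proof (rule dirichlet_solution_vanishes[OF _ drad _ dA _ nu(1,2) _ _ that])
    show "((\<lambda>t. rad t * (a1 t + a1 (- t))) has_real_derivative - (nu\<^sup>2 * rad t * A t)) (at t)" for t
      by (rule derivative_eq_intros da1 da1m refl)+ (simp add: a2 nu A_def field_simps)
    show "\<bar>- sin t\<bar> \<le> sin t / rad t * rad t" if "t \<in> {0..pi}" for t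
      using that by (simp add: sin_ge_zero)
  qed (auto simp: A_def pp)
  have b0: "b t = 0" if "t \<in> {0<..<pi}" for t
  proof (rule dirichlet_solution_vanishes[OF _ _ _ db _ nu(1,2) _ _ that])
    show "((\<lambda>t. 1 / rad t) has_real_derivative sin t / (rad t)\<^sup>2) (at t)" for t
      by (rule derivative_eq_intros refl | simp)+ (simp add: power2_eq_square)
    show "((\<lambda>t. - l * (a t + a (- t))) has_real_derivative - (nu\<^sup>2 * (1 / rad t) * b t)) (at t)" for t
      by (rule derivative_eq_intros da dam refl)+ (simp add: nu b_def field_simps)
    show "\<bar>sin t / (rad t)\<^sup>2\<bar> \<le> sin t / rad t * (1 / rad t)" if "t \<in> {0..pi}" for t
      using that by (simp add: sin_ge_zero power2_eq_square)
  qed (auto simp: b_def pp)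
  \<comment> \<open>Any interior point would do: there the odd part, the derivative of the even
    part, and the derivatives of both equations yield zero Cauchy data for \<open>a\<close>.\<close>
  have m: "pi / 2 \<in> {0<..<pi}" by simp
  have "rad (pi/2) * (a1 (pi/2) + a1 (- (pi/2))) / rad (pi/2) = 0"
    using derivative_of_locally_zero[OF dA m] A0 by blast
  moreover have "- l * (a (pi/2) + a (- (pi/2))) / (1 / rad (pi/2)) = 0"
    using derivative_of_locally_zero[OF db m] b0 by blast
  ultimately have z: "a (pi/2) = 0" "a1 (pi/2) = 0"
    using A0[OF m] b0[OF m] l by (auto simp: A_def b_def)
  have "a t = 0 \<and> rad t * a1 t = 0"
  proof (rule linear_system_unique_zero[where s = "pi/2" and x = a and y = "\<lambda>t. rad t * a1 t"
        and p = "\<lambda>t. 1 / rad t" and q = "\<lambda>t. - l * rad t" and M = "5/2 + \<bar>l\<bar> * (5/2)"])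
    show "(a has_real_derivative 1 / rad t * (rad t * a1 t)) (at t)" for t
      using da[of t] by simp
    show "((\<lambda>t. rad t * a1 t) has_real_derivative - l * rad t * a t) (at t)" for t
      by (rule derivative_eq_intros da1 refl)+ (simp add: a2 field_simps)
    show "\<bar>- l * rad t\<bar> \<le> 5/2 + \<bar>l\<bar> * (5/2)" for t
    proof -
      have "\<bar>- l * rad t\<bar> = \<bar>l\<bar> * rad t" by (simp add: abs_mult)
      also have "\<dots> \<le> \<bar>l\<bar> * (5/2)" using rad_bounds by (intro mult_left_mono) auto
      finally show ?thesis by simp
    qed
  qed (use z in \<open>simp_all only: abs_inverse_rad_le mult_zero_right\<close>)
  then show ?thesis by simp
qed

text \<open>For the sharp constant 1 the natural Riccati function is the cotangent, singular at both
  ends. The inequality is therefore proved with every constant z < 1, where a slightly stretched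
  cotangent is regular, and z tends to 1.\<close>

lemma wirtinger_dirichlet:
  fixes h h' :: "real \<Rightarrow> real"
  assumes h: "\<And>u. (h has_real_derivative h' u) (at u)" and c: "continuous_on {0..pi} h'"
    and bc: "h 0 = 0" "h pi = 0"
  shows "integral {0..pi} (\<lambda>u. (h u)\<^sup>2) \<le> integral {0..pi} (\<lambda>u. (h' u)\<^sup>2)"
proof (rule field_le_mult_one_interval)
  fix z :: real assume z: "0 < z" "z < 1"
  define k where "k = sqrt z"
  have k: "0 < k" "k < 1" "k\<^sup>2 = z" using z by (auto simp: k_def)
  \<comment> \<open>The argument runs from (1 - k) pi/2 to (1 + k) pi/2, centred at pi/2 and
    strictly inside (0, pi).\<close>
  define e where "e u = k * u + (1 - k) * (pi / 2)" for u
  define w where "w u = k * (cos (e u) / sin (e u))" for u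
  have ch: "continuous_on {0..pi} h"
    using h by (meson DERIV_isCont continuous_at_imp_continuous_on)
  have s: "0 < sin (e u)" if "u \<in> {0..pi}" for u
  proof (rule sin_gt_zero)
    have "0 < (1 - k) * (pi / 2)" using k by simp
    then show "0 < e u" using that k unfolding e_def by (intro add_nonneg_pos) auto
    have "k * u \<le> k * pi" using that k by simp
    moreover have "k * pi < 1 * pi" using k by (intro mult_strict_right_mono) auto
    moreover have "e u = k * u + pi / 2 - k * pi / 2" by (simp add: e_def field_simps)
    ultimately show "e u < pi" by linarith
  qed
  have dw: "(w has_real_derivative - z - (w u)\<^sup>2) (at u)" if "u \<in> {0..pi}" for u
  proof -
    have n: "sin (e u) \<noteq> 0" using s[OF that] by simp
    have q: "sin (e u) * sin (e u) = 1 - cos (e u) * cos (e u)"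
      using sin_squared_eq[of "e u"] by (simp add: power2_eq_square)
    have de: "(e has_real_derivative k) (at u)"
      unfolding e_def by (auto intro!: derivative_eq_intros)
    show ?thesis unfolding w_def
      apply (rule derivative_eq_intros de refl n)+
      using n k(3)[symmetric] by (simp add: divide_simps power2_eq_square) (simp add: q algebra_simps)
  qed
  \<comment> \<open>The derivative of h^2 w, of integral zero; it falls short of h'^2 - z h^2 by
    exactly (h' - h w)^2.\<close>
  define D where "D u = 2 * h u * h' u * w u + (h u)\<^sup>2 * (- z - (w u)\<^sup>2)" for u
  have "((\<lambda>u. (h u)\<^sup>2 * w u) has_real_derivative D u) (at u)" if "u \<in> {0..pi}" for u
    unfolding D_def by (rule derivative_eq_intros h dw that refl)+ simp
  then have "(D has_integral (h pi)\<^sup>2 * w pi - (h 0)\<^sup>2 * w 0) {0..pi}"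
    by (intro fundamental_theorem_of_calculus)
      (auto intro: has_field_derivative_at_within simp: has_real_derivative_iff_has_vector_derivative[symmetric])
  then have D: "(D has_integral 0) {0..pi}" by (simp add: bc)
  have i1: "(\<lambda>u. (h' u)\<^sup>2) integrable_on {0..pi}" and i2: "(\<lambda>u. z * (h u)\<^sup>2) integrable_on {0..pi}"
    using ch c by (auto intro!: integrable_continuous_real continuous_intros)
  have "integral {0..pi} D \<le> integral {0..pi} (\<lambda>u. (h' u)\<^sup>2 - z * (h u)\<^sup>2)"
  proof (rule integral_le)
    show "D integrable_on {0..pi}" using D by blast
    show "(\<lambda>u. (h' u)\<^sup>2 - z * (h u)\<^sup>2) integrable_on {0..pi}" using i1 i2 by (rule integrable_diff)
    show "D u \<le> (h' u)\<^sup>2 - z * (h u)\<^sup>2" for u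
      using zero_le_power2[of "h' u - h u * w u"]
      by (simp add: D_def power2_eq_square algebra_simps)
  qed
  then show "z * integral {0..pi} (\<lambda>u. (h u)\<^sup>2) \<le> integral {0..pi} (\<lambda>u. (h' u)\<^sup>2)"
    using D i1 i2 by (simp add: integral_unique integral_diff)
qed

section \<open>Eigenfunctions in angular coordinates\<close>

text \<open>The Laplacian in the angular coordinates has no mixed term, so only pure second
  derivatives are recorded. Joint continuity is what differentiation under the integral sign
  requires.\<close>

definition second_partials ::
  "(real \<Rightarrow> real \<Rightarrow> real) \<Rightarrow> (real \<Rightarrow> real \<Rightarrow> real) \<Rightarrow> (real \<Rightarrow> real \<Rightarrow> real) \<Rightarrow>
   (real \<Rightarrow> real \<Rightarrow> real) \<Rightarrow> (real \<Rightarrow> real \<Rightarrow> real) \<Rightarrow> bool" where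
  "second_partials h hu huu hv hvv \<longleftrightarrow>
     (\<forall>u v. ((\<lambda>u. h u v) has_real_derivative hu u v) (at u)) \<and>
     (\<forall>u v. ((\<lambda>u. hu u v) has_real_derivative huu u v) (at u)) \<and>
     (\<forall>u v. ((\<lambda>v. h u v) has_real_derivative hv u v) (at v)) \<and>
     (\<forall>u v. ((\<lambda>v. hv u v) has_real_derivative hvv u v) (at v)) \<and>
     (\<forall>g \<in> {h, hu, huu, hv, hvv}. continuous_on UNIV (\<lambda>p. g (fst p) (snd p)))"

lemma continuous_on_section2:
  fixes g :: "real \<Rightarrow> real \<Rightarrow> real"
  assumes "continuous_on UNIV (\<lambda>p. g (fst p) (snd p))" "continuous_on s f1" "continuous_on s f2"
  shows "continuous_on s (\<lambda>x. g (f1 x) (f2 x))"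
  using continuous_on_compose2[OF assms(1) continuous_on_Pair[OF assms(2,3)]] by simp

lemma second_partialsD:
  assumes "second_partials h hu huu hv hvv"
  shows "((\<lambda>u. h u v) has_real_derivative hu u v) (at u)"
    "((\<lambda>u. hu u v) has_real_derivative huu u v) (at u)"
    "((\<lambda>v. h u v) has_real_derivative hv u v) (at v)"
    "((\<lambda>v. hv u v) has_real_derivative hvv u v) (at v)"
    "\<And>f1 f2 (s::'x::topological_space set). continuous_on s f1 \<Longrightarrow> continuous_on s f2 \<Longrightarrow> continuous_on s (\<lambda>x. h (f1 x) (f2 x))"
    "\<And>f1 f2 (s::'x::topological_space set). continuous_on s f1 \<Longrightarrow> continuous_on s f2 \<Longrightarrow> continuous_on s (\<lambda>x. hu (f1 x) (f2 x))"
    "\<And>f1 f2 (s::'x::topological_space set). continuous_on s f1 \<Longrightarrow> continuous_on s f2 \<Longrightarrow> continuous_on s (\<lambda>x. huu (f1 x) (f2 x))"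
    "\<And>f1 f2 (s::'x::topological_space set). continuous_on s f1 \<Longrightarrow> continuous_on s f2 \<Longrightarrow> continuous_on s (\<lambda>x. hv (f1 x) (f2 x))"
    "\<And>f1 f2 (s::'x::topological_space set). continuous_on s f1 \<Longrightarrow> continuous_on s f2 \<Longrightarrow> continuous_on s (\<lambda>x. hvv (f1 x) (f2 x))"
  using assms unfolding second_partials_def by (simp_all add: continuous_on_section2)

text \<open>Twice the part of \<open>h\<close> that is odd about the meridian u = a, in the
  coordinate centred at that meridian.\<close>

lemma second_partials_reflect_diff:
  assumes "second_partials h hu huu hv hvv"
  shows "second_partials (\<lambda>u v. h (a + u) v - h (a - u) v) (\<lambda>u v. hu (a + u) v + hu (a - u) v)
     (\<lambda>u v. huu (a + u) v - huu (a - u) v) (\<lambda>u v. hv (a + u) v - hv (a - u) v)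
     (\<lambda>u v. hvv (a + u) v - hvv (a - u) v)"
proof -
  note d = second_partialsD[OF assms]
  have p: "((\<lambda>u. a + u) has_real_derivative 1) (at u)" "((\<lambda>u. a - u) has_real_derivative -1) (at u)" for u
    by (auto intro!: derivative_eq_intros)
  have 1: "((\<lambda>u. h (a + u) v - h (a - u) v) has_real_derivative hu (a + u) v + hu (a - u) v) (at u)" for u v
    using DERIV_diff[OF DERIV_chain2[OF d(1) p(1)] DERIV_chain2[OF d(1) p(2)]] by simp
  have 2: "((\<lambda>u. hu (a + u) v + hu (a - u) v) has_real_derivative huu (a + u) v - huu (a - u) v) (at u)" for u v
    using DERIV_add[OF DERIV_chain2[OF d(2) p(1)] DERIV_chain2[OF d(2) p(2)]] by simp
  show ?thesis
    unfolding second_partials_def using 1 2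
    by (auto intro!: DERIV_diff d(3,4) continuous_intros d(5-9))
qed

text \<open>Picone's identity with the positive supersolution \<open>\<phi> v \<cdot> sin u\<close> on the half torus \<open>0 < u < \<pi>\<close>,
  in the form of a monotone quantity in \<open>v\<close>.\<close>

lemma half_torus_dirichlet_vanishes:
  assumes P: "second_partials H Hu Huu Hv Hvv"
    and pde: "\<And>u v. Huu u v / (rad v)\<^sup>2 + Hvv u v - sin v / rad v * Hv u v + l * H u v = 0"
    and dir: "\<And>v. H 0 v = 0" "\<And>v. H pi v = 0" and per: "\<And>u v. H u (v + 2 * pi) = H u v"
    and g: "subcritical l" and u: "u \<in> {0..pi}" and v: "v \<in> {-pi..pi}"
  shows "H u v = 0"
proof -
  note d = second_partialsD[OF P]
  have perv: "Hv u (v + 2 * pi) = Hv u v" for u v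
  proof -
    have "((\<lambda>v. H u (v + 2 * pi)) has_real_derivative Hv u (v + 2 * pi)) (at v)"
      using d(3)[of u "v + 2 * pi"] by (simp add: DERIV_shift)
    then show ?thesis using d(3)[of u v] by (simp add: per DERIV_unique)
  qed
  have pp: "H u (- pi) = H u pi" "Hv u (- pi) = Hv u pi" for u
    using per[of u "- pi"] perv[of u "- pi"] by simp_all
  have phi: "0 < phi l v" if "v \<in> {-pi..pi}" for v
  proof (cases "0 \<le> v")
    case True then show ?thesis using g that by (auto simp: subcritical_def)
  next
    case False
    then have "0 < phi l (- v)" using g that by (auto simp: subcritical_def)
    then show ?thesis by (simp add: phi_even)
  qed
  define w where "w v = chi l v / phi l v" for v
  define w' where "w' v = (1 / rad v - l * rad v) - (w v)\<^sup>2 / rad v" for v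
  have dw: "(w has_real_derivative w' v) (at v)" if "v \<in> {-pi..pi}" for v
  proof -
    have n: "phi l v \<noteq> 0" using phi[OF that] by simp
    show ?thesis unfolding w_def
      by (rule field_derivative_eqI, (rule derivative_eq_intros refl n)+)
        (use n in \<open>simp add: w'_def w_def field_simps power2_eq_square\<close>)
  qed
  have cw: "continuous_on {-pi..pi} w"
    using dw by (meson DERIV_isCont continuous_at_imp_continuous_on)
  have cw': "continuous_on {-pi..pi} w'"
    unfolding w'_def by (intro continuous_intros cw) auto
  \<comment> \<open>At fixed u this is the one-dimensional Picone quantity with weight r: H times
    its flux r Hv, minus H^2 times the logarithmic flux w of the supersolution.\<close>
  define Q where "Q v u = rad v * H u v * Hv u v - (H u v)\<^sup>2 * w v" for v u
  define Q' where "Q' v u = - sin v * H u v * Hv u v + rad v * (Hv u v * Hv u v + H u v * Hvv u v)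
      - (2 * H u v * Hv u v * w v + (H u v)\<^sup>2 * w' v)" for v u
  \<comment> \<open>The differential equation and the Riccati equation of w cancel the terms in
    \<open>l\<close>. A square remains, plus a term in u-derivatives that has a sign only after
    integration over u.\<close>
  have Q'_eq: "Q' v u = (rad v * Hv u v - H u v * w v)\<^sup>2 / rad v - (1 / rad v) * ((H u v)\<^sup>2 + H u v * Huu u v)" for u v
  proof -
    have e: "Hvv u v = sin v / rad v * Hv u v - Huu u v / (rad v)\<^sup>2 - l * H u v" using pde[of u v] by linarith
    have "rad v * Hvv u v = sin v * Hv u v - Huu u v / rad v - l * rad v * H u v"
      unfolding e by (simp add: field_simps power2_eq_square)
    then have 1: "Q' v u = rad v * (Hv u v)\<^sup>2 - H u v * (Huu u v / rad v) - l * rad v * (H u v)\<^sup>2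
        - 2 * H u v * Hv u v * w v - (H u v)\<^sup>2 * (1 / rad v) + l * rad v * (H u v)\<^sup>2 + (H u v)\<^sup>2 * ((w v)\<^sup>2 / rad v)"
      unfolding Q'_def w'_def by algebra
    have 2: "(rad v * Hv u v - H u v * w v)\<^sup>2 / rad v =
        rad v * (Hv u v)\<^sup>2 - 2 * H u v * Hv u v * w v + (H u v)\<^sup>2 * ((w v)\<^sup>2 / rad v)"
      by (simp add: field_simps power2_eq_square)
    show ?thesis unfolding 1 2 by (simp add: divide_inverse algebra_simps)
  qed
  have dQ: "((\<lambda>v. Q v u) has_real_derivative Q' v u) (at v)" if "v \<in> {-pi..pi}" for u v
    unfolding Q_def Q'_def
    by (rule derivative_eq_intros d(3,4) dw that refl)+ (simp add: algebra_simps)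
  have cw2: "continuous_on ({-pi..pi} \<times> {0..pi}) (\<lambda>x. w (fst x))"
    "continuous_on ({-pi..pi} \<times> {0..pi}) (\<lambda>x. w' (fst x))"
    by (rule continuous_on_compose2[OF cw] continuous_on_compose2[OF cw']; auto intro!: continuous_intros)+
  have cQ': "continuous_on ({-pi..pi} \<times> {0..pi}) (\<lambda>x. Q' (fst x) (snd x))"
    unfolding Q'_def by (intro continuous_intros d(5,8,9) cw2)
  have cQ: "continuous_on {0..pi} (Q v)" for v
    unfolding Q_def by (intro continuous_intros d(5,8))
  define F where "F v = integral {0..pi} (Q v)" for v
  have dF: "(F has_real_derivative integral {0..pi} (Q' v)) (at v within {-pi..pi})" if "v \<in> {-pi..pi}" for v
  proof -
    have "((\<lambda>v. integral (cbox 0 pi) (Q v)) has_real_derivative integral (cbox 0 pi) (Q' v)) (at v within {-pi..pi})"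
    proof (rule leibniz_rule_field_derivative[OF _ _ _ that])
      show "((\<lambda>v. Q v u) has_real_derivative Q' v u) (at v within {-pi..pi})" if "v \<in> {-pi..pi}" for v u
        using dQ[OF that] by (rule has_field_derivative_at_within)
      show "Q v integrable_on cbox 0 pi" for v
        using cQ by (simp add: integrable_continuous_real)
      show "continuous_on ({-pi..pi} \<times> cbox 0 pi) (\<lambda>(x, t). Q' x t)"
        using cQ' by (simp add: split_def)
    qed simp
    then show ?thesis unfolding F_def[abs_def] by simp
  qed
  have cH: "continuous_on {0..pi} (\<lambda>u. H u v)" "continuous_on {0..pi} (\<lambda>u. Hu u v)"
    "continuous_on {0..pi} (\<lambda>u. Huu u v)" "continuous_on {0..pi} (\<lambda>u. Hv u v)" for v
    by (intro d(5-9) continuous_intros)+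
  define S where "S v = integral {0..pi} (\<lambda>u. (rad v * Hv u v - H u v * w v)\<^sup>2 / rad v)" for v
  have S0: "0 \<le> S v" for v
    unfolding S_def by (intro integral_nonneg) (auto intro!: integrable_continuous_real continuous_intros cH)
  \<comment> \<open>Integrating by parts with the Dirichlet conditions turns the u-term into the
    integral of H^2 - Hu^2, which is nonpositive by the sharp Wirtinger inequality.\<close>
  have SQ: "S v \<le> integral {0..pi} (Q' v)" for v
  proof -
    have "((\<lambda>u. H u v * Hu u v) has_real_derivative (Hu u v)\<^sup>2 + H u v * Huu u v) (at u)" for u
      by (rule derivative_eq_intros d(1,2) refl)+ (simp add: power2_eq_square)
    then have "((\<lambda>u. (Hu u v)\<^sup>2 + H u v * Huu u v) has_integral H pi v * Hu pi v - H 0 v * Hu 0 v) {0..pi}"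
      by (intro fundamental_theorem_of_calculus)
        (auto intro: has_field_derivative_at_within simp: has_real_derivative_iff_has_vector_derivative[symmetric])
    then have z: "integral {0..pi} (\<lambda>u. (Hu u v)\<^sup>2 + H u v * Huu u v) = 0"
      by (simp add: dir integral_unique)
    have i: "(\<lambda>u. (Hu u v)\<^sup>2) integrable_on {0..pi}" "(\<lambda>u. (H u v)\<^sup>2) integrable_on {0..pi}"
      "(\<lambda>u. H u v * Huu u v) integrable_on {0..pi}"
      "(\<lambda>u. (rad v * Hv u v - H u v * w v)\<^sup>2 / rad v) integrable_on {0..pi}"
      by (intro integrable_continuous_real continuous_intros cH | simp)+
    have "integral {0..pi} (\<lambda>u. (Hu u v)\<^sup>2) + integral {0..pi} (\<lambda>u. H u v * Huu u v) = 0"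
      using z i by (simp add: integral_add)
    moreover have "integral {0..pi} (\<lambda>u. (H u v)\<^sup>2) \<le> integral {0..pi} (\<lambda>u. (Hu u v)\<^sup>2)"
      using wirtinger_dirichlet[of "\<lambda>u. H u v" "\<lambda>u. Hu u v"] d(1) cH dir by blast
    ultimately have neg: "integral {0..pi} (\<lambda>u. (H u v)\<^sup>2 + H u v * Huu u v) \<le> 0"
      using i by (simp add: integral_add)
    have "integral {0..pi} (Q' v) = S v - (1 / rad v) * integral {0..pi} (\<lambda>u. (H u v)\<^sup>2 + H u v * Huu u v)"
    proof -
      have "Q' v = (\<lambda>u. (rad v * Hv u v - H u v * w v)\<^sup>2 / rad v - (1 / rad v) * ((H u v)\<^sup>2 + H u v * Huu u v))"
        using Q'_eq by blast
      then have "integral {0..pi} (Q' v) = S v - integral {0..pi} (\<lambda>u. (1 / rad v) * ((H u v)\<^sup>2 + H u v * Huu u v))"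
        unfolding S_def using i by (simp only: integral_diff integrable_on_mult_right integrable_add)
      then show ?thesis by simp
    qed
    moreover have "(1 / rad v) * integral {0..pi} (\<lambda>u. (H u v)\<^sup>2 + H u v * Huu u v) \<le> 0"
      using neg by (intro mult_nonneg_nonpos) auto
    ultimately show ?thesis by linarith
  qed
  have Q'0: "0 \<le> integral {0..pi} (Q' v)" for v using S0 SQ order_trans by blast
  have wpi: "0 < w pi" "w (- pi) = - w pi"
    using g phi[of pi] by (simp_all add: w_def chi_odd phi_even subcritical_def)
  have iH: "(\<lambda>u. (H u pi)\<^sup>2) integrable_on {0..pi}"
    by (intro integrable_continuous_real continuous_intros cH)
  \<comment> \<open>The corner of the supersolution: H and Hv are periodic, but w jumps from w(pi)
    to -w(pi), so F loses a nonnegative amount around the circle although it is nondecreasing in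
    between.\<close>
  have Fdiff: "F pi = F (- pi) - 2 * w pi * integral {0..pi} (\<lambda>u. (H u pi)\<^sup>2)"
  proof -
    have "Q pi u = Q (- pi) u - 2 * w pi * (H u pi)\<^sup>2" for u
      by (simp add: Q_def pp wpi)
    then have "F pi = integral {0..pi} (\<lambda>u. Q (- pi) u - 2 * w pi * (H u pi)\<^sup>2)"
      unfolding F_def by presburger
    also have "\<dots> = F (- pi) - integral {0..pi} (\<lambda>u. 2 * w pi * (H u pi)\<^sup>2)"
      unfolding F_def
      using integral_diff[OF integrable_continuous_real[OF cQ[of "- pi"]] integrable_on_mult_right[OF iH, of "2 * w pi"]] by simp
    finally show ?thesis by simp
  qed
  have I0: "0 \<le> integral {0..pi} (\<lambda>u. (H u pi)\<^sup>2)"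
    by (intro integral_nonneg iH) simp
  then have "0 \<le> 2 * w pi * integral {0..pi} (\<lambda>u. (H u pi)\<^sup>2)" using wpi(1) by simp
  then have Fle: "F pi \<le> F (- pi)" using Fdiff by linarith
  have "F pi = F (- pi)"
    using nonneg_derivative_eq_zero(2)[OF dF Q'0 Fle, of 0 pi] by simp
  then have "integral {0..pi} (\<lambda>u. (H u pi)\<^sup>2) = 0" using Fdiff wpi(1) by simp
  note Ipi = this
  have Hpi: "H u pi = 0" if "u \<in> {0..pi}" for u
  proof -
    have "continuous_on {0..pi} (\<lambda>u. (H u pi)\<^sup>2)" by (intro continuous_intros cH)
    then show ?thesis using Ipi that
        integral_eq_0_iff[of 0 pi "\<lambda>u. (H u pi)\<^sup>2"] by simp
  qed
  have Hv: "rad v * Hv u v = H u v * w v" if "v \<in> {-pi<..<pi}" "u \<in> {0..pi}" for u v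
  proof -
    have "integral {0..pi} (Q' v) = 0"
      using nonneg_derivative_eq_zero(1)[OF dF Q'0 Fle that(1)] .
    then have "S v = 0" using S0[of v] SQ[of v] by linarith
    moreover have "continuous_on {0..pi} (\<lambda>u. (rad v * Hv u v - H u v * w v)\<^sup>2 / rad v)"
      by (intro continuous_intros cH) simp
    ultimately have "(rad v * Hv u v - H u v * w v)\<^sup>2 / rad v = 0"
      using that integral_eq_0_iff[of 0 pi "\<lambda>u. (rad v * Hv u v - H u v * w v)\<^sup>2 / rad v"]
      unfolding S_def by simp
    then show ?thesis by simp
  qed
  \<comment> \<open>Equality in Picone makes H proportional to \<open>phi\<close> along each
    meridian, and the corner term has already shown that H vanishes at v = pi.\<close>
  have "H u v / phi l v = H u pi / phi l pi"
  proof (cases "v = pi")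
    case False
    then have "v < pi" using v by simp
    show ?thesis
    proof (rule DERIV_isconst2[symmetric, where a = "v" and b = pi])
      show "continuous_on {v..pi} (\<lambda>v. H u v / phi l v)"
        using v phi by (intro continuous_intros d(5)) (auto dest!: phi simp: less_imp_neq[symmetric])
      fix t assume t: "v < t" "t < pi"
      then have "t \<in> {-pi..pi}" "t \<in> {-pi<..<pi}" using v by auto
      then have n: "phi l t \<noteq> 0" and e: "rad t * Hv u t = H u t * w t"
        using phi[of t] Hv[of t u] u by auto
      have e': "Hv u t = H u t * (chi l t / phi l t) / rad t"
        unfolding e[unfolded w_def, symmetric] by simp
      show "((\<lambda>v. H u v / phi l v) has_real_derivative 0) (at t)"
        by (rule field_derivative_eqI, (rule derivative_eq_intros d(3) refl n)+)
          (use n in \<open>simp add: e' field_simps\<close>)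
    qed (use \<open>v < pi\<close> in auto)
  qed simp
  then show ?thesis using Hpi[OF u] phi[OF v] by simp
qed

text \<open>The odd part of \<open>h\<close> about every meridian is a Dirichlet eigenfunction of the half torus, so
  \<open>h\<close> is rotationally symmetric.\<close>

lemma small_eigenfunction_vanishes:
  assumes P: "second_partials h hu huu hv hvv"
    and pde: "\<And>u v. huu u v / (rad v)\<^sup>2 + hvv u v - sin v / rad v * hv u v + l * h u v = 0"
    and peru: "\<And>u v. h (u + 2 * pi) v = h u v" and perv: "\<And>u v. h u (v + 2 * pi) = h u v"
    and g: "subcritical l" and l: "0 < l" "l < 4/9"
  shows "h u v = 0"
proof -
  note d = second_partialsD[OF P]
  have sym: "h (a + u) v = h (a - u) v" if u: "u \<in> {0..pi}" for a u v
  proof -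
    have per: "(\<lambda>v. h (a + u) v - h (a - u) v) (t + 2 * pi) = (\<lambda>v. h (a + u) v - h (a - u) v) t" for t
      by (simp add: perv)
    obtain s where s: "s \<in> {-pi..pi}" "h (a + u) s - h (a - u) s = h (a + u) v - h (a - u) v"
      by (rule periodic_representative[of "\<lambda>v. h (a + u) v - h (a - u) v" v, OF per])
    have "h (a + u) s - h (a - u) s = 0"
    proof (rule half_torus_dirichlet_vanishes[OF second_partials_reflect_diff[OF P] _ _ _ _ g u s(1)])
      fix u v
      show "(huu (a + u) v - huu (a - u) v) / (rad v)\<^sup>2 + (hvv (a + u) v - hvv (a - u) v)
          - sin v / rad v * (hv (a + u) v - hv (a - u) v) + l * (h (a + u) v - h (a - u) v) = 0"
        using pde[of "a + u" v] pde[of "a - u" v] by (simp add: diff_divide_distrib right_diff_distrib)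
      \<comment> \<open>The two arguments differ by a full turn, so the odd part also vanishes on
        the opposite meridian.\<close>
      have "a - pi + 2 * pi = a + pi" by simp
      then show "h (a + pi) v - h (a - pi) v = 0" for v
        using peru[of "a - pi" v] by (simp only: right_minus_eq)
    qed (simp_all add: perv)
    then show ?thesis using s by simp
  qed
  \<comment> \<open>Reflection about the meridian u/2 exchanges u and 0.\<close>
  have const: "h u v = h 0 v" if "u \<in> {0..2*pi}" for u v
    using sym[of "u/2" "u/2" v] that by simp
  have hu0: "hu u v = 0" if u: "u \<in> {0<..<2*pi}" for u v
  proof (rule derivative_of_locally_zero[OF _ u])
    show "((\<lambda>u. h u v - h 0 v) has_real_derivative hu u v) (at u)"
      by (rule field_derivative_eqI[OF DERIV_diff[OF d(1) DERIV_const]]) simp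
    show "h s v - h 0 v = 0" if "s \<in> {0<..<2*pi}" for s using const[of s v] that by simp
  qed
  \<comment> \<open>An arbitrary interior longitude: there constancy in u holds on both sides, so
    the second derivative vanishes too and the equation becomes the radial one.\<close>
  have one: "(1::real) \<in> {0<..<2*pi}" using pi_gt3 by simp
  have huu0: "huu 1 v = 0" for v
    by (rule derivative_of_locally_zero[OF d(2) one hu0])
  have h1: "h 1 v = 0" for v
  proof (rule periodic_radial_solution_vanishes[OF d(3) d(4) _ perv l])
    show "hvv 1 t - sin t / rad t * hv 1 t + l * h 1 t = 0" for t
      using pde[of 1 t] huu0[of t] by simp
  qed
  have "(\<lambda>u. h (u + pi) v) (t + 2 * pi) = (\<lambda>u. h (u + pi) v) t" for t
    using peru[of "t + pi" v] by (simp add: ac_simps)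
  from periodic_representative[of "\<lambda>u. h (u + pi) v" "u - pi", OF this]
  obtain s where s: "s \<in> {-pi..pi}" "h (s + pi) v = h (u - pi + pi) v" by blast
  then show ?thesis using const[of "s + pi" v] const[of 1 v] h1[of v] one by simp
qed

section \<open>The torus as a submanifold\<close>

text \<open>Longitude u and angle v on the generating circle, with v = 0 on the outer equator.
  \<open>e_lon\<close>, \<open>e_lat\<close> and \<open>e_nor\<close> form an orthonormal frame with
  outward normal; the horizontal direction \<open>e_rad\<close> enters because the derivative of
  \<open>e_lon\<close> is its negative.\<close>

definition torus_point :: "real \<Rightarrow> real \<Rightarrow> real^3" where
  "torus_point u v = vector [rad v * cos u, rad v * sin u, sin v]"
definition e_lon :: "real \<Rightarrow> real^3" where "e_lon u = vector [- sin u, cos u, 0]"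
definition e_rad :: "real \<Rightarrow> real^3" where "e_rad u = vector [cos u, sin u, 0]"
definition e_lat :: "real \<Rightarrow> real \<Rightarrow> real^3" where
  "e_lat u v = vector [- sin v * cos u, - sin v * sin u, cos v]"
definition e_nor :: "real \<Rightarrow> real \<Rightarrow> real^3" where
  "e_nor u v = vector [cos v * cos u, cos v * sin u, sin v]"

lemmas frame_defs = torus_point_def e_lon_def e_rad_def e_lat_def e_nor_def

lemma inner_3: "(x::real^3) \<bullet> y = x$1 * y$1 + x$2 * y$2 + x$3 * y$3"
  by (simp add: inner_vec_def sum_3)

lemma vec_eq_3: "(x::real^3) = y \<longleftrightarrow> x$1 = y$1 \<and> x$2 = y$2 \<and> x$3 = y$3"
  by (simp add: vec_eq_iff forall_3)

lemma frame_inner: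
  "e_lon u \<bullet> e_lon u = 1" "e_lat u v \<bullet> e_lat u v = 1" "e_nor u v \<bullet> e_nor u v = 1"
  "e_lon u \<bullet> e_lat u v = 0" "e_lon u \<bullet> e_nor u v = 0" "e_lat u v \<bullet> e_nor u v = 0"
  "e_rad u \<bullet> e_lon u = 0" "e_rad u \<bullet> e_lat u v = - sin v"
proof -
  have u: "cos u * cos u = 1 - sin u * sin u" and v: "cos v * cos v = 1 - sin v * sin v"
    using cos_squared_eq[of u] cos_squared_eq[of v] by (simp_all add: power2_eq_square)
  show "e_lon u \<bullet> e_lon u = 1" "e_lon u \<bullet> e_lat u v = 0" "e_lon u \<bullet> e_nor u v = 0" "e_rad u \<bullet> e_lon u = 0"
    using u by (simp_all add: inner_3 frame_defs)
  show "e_lat u v \<bullet> e_lat u v = 1" "e_nor u v \<bullet> e_nor u v = 1" "e_lat u v \<bullet> e_nor u v = 0"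
    "e_rad u \<bullet> e_lat u v = - sin v"
    unfolding inner_3 frame_defs vector_3 using u v by algebra+
qed

lemma frame_expand:
  "x = (x \<bullet> e_lon u) *\<^sub>R e_lon u + (x \<bullet> e_lat u v) *\<^sub>R e_lat u v + (x \<bullet> e_nor u v) *\<^sub>R e_nor u v"
proof -
  have u: "cos u * cos u = 1 - sin u * sin u" and v: "cos v * cos v = 1 - sin v * sin v"
    using cos_squared_eq[of u] cos_squared_eq[of v] by (simp_all add: power2_eq_square)
  show ?thesis
    unfolding vec_eq_3 inner_3 frame_defs vector_3 vector_add_component vector_scaleR_component real_scaleR_def
    by (intro conjI; use u v in algebra)
qed

lemma torus_point_radius_sq: "(torus_point u v $ 1)\<^sup>2 + (torus_point u v $ 2)\<^sup>2 = (rad v)\<^sup>2"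
proof -
  have "(rad v * cos u)\<^sup>2 + (rad v * sin u)\<^sup>2 = (rad v)\<^sup>2 * ((sin u)\<^sup>2 + (cos u)\<^sup>2)"
    by (simp only: power_mult_distrib distrib_left add.commute)
  then show ?thesis by (simp add: torus_point_def)
qed

lemma torus_point_radius: "sqrt ((torus_point u v $ 1)\<^sup>2 + (torus_point u v $ 2)\<^sup>2) = rad v"
  by (simp add: torus_point_radius_sq)

lemma torus_point_in [simp]: "torus_point u v \<in> torus_sqrt2"
  unfolding torus_sqrt2_def mem_Collect_eq torus_point_radius by (simp add: torus_point_def rad_def)

lemma torus_point_exists:
  assumes "p \<in> torus_sqrt2"
  obtains u v where "p = torus_point u v"
proof -
  define rho where "rho = sqrt ((p$1)\<^sup>2 + (p$2)\<^sup>2)"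
  have "(rho - sqrt 2)\<^sup>2 + (p$3)\<^sup>2 = 1" using assms by (simp add: torus_sqrt2_def rho_def)
  then obtain v where v: "rho - sqrt 2 = cos v" "p$3 = sin v" using sincos_total_2pi by metis
  then have rho: "rho = rad v" by (simp add: rad_def)
  have "(p$1)\<^sup>2 + (p$2)\<^sup>2 = (rad v)\<^sup>2" using rho unfolding rho_def
    by (metis real_sqrt_pow2 sum_power2_ge_zero)
  then have "(p$1 / rad v)\<^sup>2 + (p$2 / rad v)\<^sup>2 = 1"
    by (simp add: power_divide add_divide_distrib[symmetric])
  then obtain u where u: "p$1 / rad v = cos u" "p$2 / rad v = sin u" using sincos_total_2pi by metis
  have "p$1 = rad v * cos u" "p$2 = rad v * sin u"
    using u rad_pos(2)[of v] by (auto simp: field_simps)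
  then have "p = torus_point u v" using v by (simp add: vec_eq_3 torus_point_def)
  then show thesis by (rule that)
qed

lemma has_vector_derivative_vector_3 [derivative_intros]:
  assumes "(f has_real_derivative f') (at t within s)" "(g has_real_derivative g') (at t within s)"
    "(h has_real_derivative h') (at t within s)"
  shows "((\<lambda>t. vector [f t, g t, h t] :: real^3) has_vector_derivative vector [f', g', h']) (at t within s)"
proof -
  have e: "vector [a, b, c] = a *\<^sub>R axis 1 1 + b *\<^sub>R axis 2 1 + c *\<^sub>R (axis 3 1 :: real^3)" for a b c :: real
    by (simp add: vec_eq_3 axis_def)
  have "((\<lambda>t. f t *\<^sub>R axis 1 1 + g t *\<^sub>R axis 2 1 + h t *\<^sub>R (axis 3 1 :: real^3)) has_vector_derivative
      (f t *\<^sub>R 0 + f' *\<^sub>R axis 1 1) + (g t *\<^sub>R 0 + g' *\<^sub>R axis 2 1) + (h t *\<^sub>R 0 + h' *\<^sub>R axis 3 1)) (at t within s)"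
    by (intro has_vector_derivative_add has_vector_derivative_scaleR has_vector_derivative_const assms)
  then show ?thesis unfolding e by simp
qed

lemma torus_point_curve:
  assumes "(f has_real_derivative f') (at t)" "(g has_real_derivative g') (at t)"
  shows "((\<lambda>t. torus_point (f t) (g t)) has_vector_derivative
           (rad (g t) * f') *\<^sub>R e_lon (f t) + g' *\<^sub>R e_lat (f t) (g t)) (at t)"
proof -
  have "((\<lambda>t. torus_point (f t) (g t)) has_vector_derivative
     vector [- sin (g t) * g' * cos (f t) + - sin (f t) * f' * rad (g t),
             - sin (g t) * g' * sin (f t) + cos (f t) * f' * rad (g t), cos (g t) * g']) (at t)"
    unfolding torus_point_def
    by (intro has_vector_derivative_vector_3 DERIV_mult DERIV_rad DERIV_fun_cos DERIV_fun_sin assms)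
  moreover have "vector [- sin (g t) * g' * cos (f t) + - sin (f t) * f' * rad (g t),
             - sin (g t) * g' * sin (f t) + cos (f t) * f' * rad (g t), cos (g t) * g']
      = (rad (g t) * f') *\<^sub>R e_lon (f t) + g' *\<^sub>R e_lat (f t) (g t)"
    by (simp add: vec_eq_3 frame_defs)
  ultimately show ?thesis by simp
qed

lemma frame_derivatives:
  "((\<lambda>u. torus_point u v) has_vector_derivative rad v *\<^sub>R e_lon u) (at u)"
  "((\<lambda>v. torus_point u v) has_vector_derivative e_lat u v) (at v)"
  "(e_lon has_vector_derivative - e_rad u) (at u)"
  "((\<lambda>v. e_lat u v) has_vector_derivative - e_nor u v) (at v)"
proof -
  show "((\<lambda>u. torus_point u v) has_vector_derivative rad v *\<^sub>R e_lon u) (at u)"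
    using torus_point_curve[of "\<lambda>u. u" 1 u "\<lambda>_. v" 0] by simp
  show "((\<lambda>v. torus_point u v) has_vector_derivative e_lat u v) (at v)"
    using torus_point_curve[of "\<lambda>_. u" 0 v "\<lambda>v. v" 1] by simp
  have "- e_rad u = vector [- cos u, - sin u, 0]" by (simp add: vec_eq_3 frame_defs)
  then show "(e_lon has_vector_derivative - e_rad u) (at u)"
    unfolding e_lon_def[abs_def] by (auto intro!: has_vector_derivative_vector_3 derivative_eq_intros)
  have "- e_nor u v = vector [- cos v * cos u, - cos v * sin u, - sin v]"
    by (simp add: vec_eq_3 frame_defs)
  then show "((\<lambda>v. e_lat u v) has_vector_derivative - e_nor u v) (at v)"
    unfolding e_lat_def[abs_def] by (auto intro!: has_vector_derivative_vector_3 derivative_eq_intros)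
qed

text \<open>Every vector orthogonal to the normal is the velocity of a curve whose two angles are
  affine in t. Conversely, differentiating the defining equation along a curve gives orthogonality;
  the root is differentiable there because the distance from the axis is positive.\<close>

lemma tangent_space_torus:
  "tangent_space torus_sqrt2 (torus_point u v) = {w. w \<bullet> e_nor u v = 0}"
proof (intro equalityI subsetI)
  fix w assume "w \<in> {w. w \<bullet> e_nor u v = 0}"
  then have w: "w = (w \<bullet> e_lon u) *\<^sub>R e_lon u + (w \<bullet> e_lat u v) *\<^sub>R e_lat u v"
    using frame_expand[of w u v] by simp
  let ?f = "\<lambda>t. u + t * ((w \<bullet> e_lon u) / rad v)" and ?g = "\<lambda>t. v + t * (w \<bullet> e_lat u v)"
  have "(?f has_real_derivative (w \<bullet> e_lon u) / rad v) (at 0)" "(?g has_real_derivative w \<bullet> e_lat u v) (at 0)"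
    by (auto intro!: derivative_eq_intros)
  from torus_point_curve[OF this]
  have "((\<lambda>t. torus_point (?f t) (?g t)) has_vector_derivative w) (at 0)"
    using w by simp
  then have "curve_in torus_sqrt2 (torus_point u v) w (\<lambda>t. torus_point (?f t) (?g t))"
    by (simp add: curve_in_def)
  then show "w \<in> tangent_space torus_sqrt2 (torus_point u v)" by (auto simp: tangent_space_def)
next
  fix w assume "w \<in> tangent_space torus_sqrt2 (torus_point u v)"
  then obtain c where c: "\<And>t. c t \<in> torus_sqrt2" "c 0 = torus_point u v" "(c has_vector_derivative w) (at 0)"
    by (auto simp: tangent_space_def curve_in_def)
  have d: "((\<lambda>t. c t $ i) has_real_derivative w $ i) (at 0)" for i
    using bounded_linear.has_vector_derivative[OF bounded_linear_vec_nth c(3)]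
    by (simp add: has_real_derivative_iff_has_vector_derivative)
  define rho where "rho t = sqrt ((c t $ 1)\<^sup>2 + (c t $ 2)\<^sup>2)" for t
  have c0: "c 0 $ 1 = rad v * cos u" "c 0 $ 2 = rad v * sin u" "c 0 $ 3 = sin v"
    by (simp_all add: c torus_point_def)
  have sq: "(c 0 $ 1)\<^sup>2 + (c 0 $ 2)\<^sup>2 = (rad v)\<^sup>2" unfolding c(2) by (rule torus_point_radius_sq)
  have dsq: "((\<lambda>t. (c t $ 1)\<^sup>2 + (c t $ 2)\<^sup>2) has_real_derivative 2 * rad v * (cos u * w$1 + sin u * w$2)) (at 0)"
    by (rule derivative_eq_intros d refl)+ (simp add: c0 algebra_simps)
  have "(rho has_real_derivative inverse (sqrt ((c 0 $ 1)\<^sup>2 + (c 0 $ 2)\<^sup>2)) / 2 * (2 * rad v * (cos u * w$1 + sin u * w$2))) (at 0)"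
    unfolding rho_def by (rule DERIV_chain2[OF DERIV_real_sqrt dsq]) (simp add: sq)
  moreover have "inverse (rad v) / 2 * (2 * rad v * X) = X" for X by simp
  ultimately have drho: "(rho has_real_derivative cos u * w$1 + sin u * w$2) (at 0)"
    by (simp only: sq real_sqrt_abs abs_of_nonneg rad_pos(3))
  have "((\<lambda>t. (rho t - sqrt 2)\<^sup>2 + (c t $ 3)\<^sup>2) has_real_derivative
      2 * (rho 0 - sqrt 2) * (cos u * w$1 + sin u * w$2) + 2 * c 0 $ 3 * w $ 3) (at 0)"
    by (rule derivative_eq_intros d drho refl)+ simp
  moreover have "(\<lambda>t. (rho t - sqrt 2)\<^sup>2 + (c t $ 3)\<^sup>2) = (\<lambda>t. 1)"
    using c(1) by (simp add: torus_sqrt2_def rho_def)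
  ultimately have "((\<lambda>t. 1) has_real_derivative
      2 * (rho 0 - sqrt 2) * (cos u * w$1 + sin u * w$2) + 2 * c 0 $ 3 * w $ 3) (at 0)" by simp
  then have "2 * (rho 0 - sqrt 2) * (cos u * w$1 + sin u * w$2) + 2 * c 0 $ 3 * w $ 3 = 0"
    by (rule DERIV_unique[OF _ DERIV_const])
  moreover have "rho 0 - sqrt 2 = cos v" by (simp add: rho_def sq) (simp add: rad_def)
  ultimately have "2 * (w \<bullet> e_nor u v) = 0"
    by (simp add: inner_3 frame_defs c0 algebra_simps)
  then show "w \<in> {w. w \<bullet> e_nor u v = 0}" by simp
qed

text \<open>The chain rule applied to a local extension G off S: a curve through p stays in U for
  small times. Tangency of v supplies a curve, without which the definite description would not be
  determined.\<close>

lemma deriv_along_eqI: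
  assumes v: "v \<in> tangent_space S p" and d: "(G has_derivative L) (at p)"
    and U: "open U" "p \<in> U" "\<And>q. q \<in> S \<inter> U \<Longrightarrow> G q = F q"
  shows "deriv_along S F p v = L v"
  unfolding deriv_along_def
proof (rule the_equality)
  have *: "((F \<circ> c) has_vector_derivative L v) (at 0)" if c: "curve_in S p v c" for c
  proof -
    have c': "(c has_vector_derivative v) (at 0)" "c 0 = p" "\<And>t. c t \<in> S"
      using c by (auto simp: curve_in_def)
    have Gc: "((G \<circ> c) has_vector_derivative L v) (at 0)"
      using vector_derivative_diff_chain_within[OF c'(1)] d c'(2) has_derivative_at_withinI by metis
    have "continuous (at 0) c"
      using c'(1) has_vector_derivative_continuous by blast
    then obtain e where "0 < e" and e: "\<And>t. dist t 0 < e \<Longrightarrow> c t \<in> U"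
    proof -
      obtain r where r: "0 < r" "ball p r \<subseteq> U" using U(1,2) open_contains_ball by blast
      obtain e where "0 < e" "\<And>t. dist t 0 < e \<Longrightarrow> dist (c t) (c 0) < r"
        using \<open>continuous (at 0) c\<close> r(1) unfolding continuous_at_eps_delta by blast
      then show thesis using that r(2) c'(2) by (metis dist_commute mem_ball subsetD)
    qed
    show ?thesis
      by (rule has_vector_derivative_transform_within[OF Gc \<open>0 < e\<close>]) (use e U(3) c'(3) in auto)
  qed
  then show "\<forall>c. curve_in S p v c \<longrightarrow> ((F \<circ> c) has_vector_derivative L v) (at 0)" by blast
  obtain c where "curve_in S p v c" using v by (auto simp: tangent_space_def)
  then show "\<And>d. \<forall>c. curve_in S p v c \<longrightarrow> ((F \<circ> c) has_vector_derivative d) (at 0) \<Longrightarrow> d = L v"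
    using * vector_derivative_unique_at by blast
qed

text \<open>The intrinsic gradient is the tangential part of the ambient gradient of any local
  extension, read off in the frame.\<close>

lemma gradient_torus:
  assumes d: "(G has_derivative L) (at (torus_point u v))"
    and U: "open U" "torus_point u v \<in> U" "\<And>q. q \<in> torus_sqrt2 \<inter> U \<Longrightarrow> G q = f q"
  shows "gradient torus_sqrt2 f (torus_point u v) = L (e_lon u) *\<^sub>R e_lon u + L (e_lat u v) *\<^sub>R e_lat u v"
  unfolding gradient_def
proof (rule the_equality)
  let ?g = "L (e_lon u) *\<^sub>R e_lon u + L (e_lat u v) *\<^sub>R e_lat u v"
  interpret L: linear L using d by (rule has_derivative_linear)
  have da: "deriv_along torus_sqrt2 f (torus_point u v) w = L w"
    if "w \<in> tangent_space torus_sqrt2 (torus_point u v)" for w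
    by (rule deriv_along_eqI[OF that d U])
  have tan: "e_lon u \<in> tangent_space torus_sqrt2 (torus_point u v)"
    "e_lat u v \<in> tangent_space torus_sqrt2 (torus_point u v)"
    by (simp_all add: tangent_space_torus frame_inner)
  show "?g \<in> tangent_space torus_sqrt2 (torus_point u v) \<and>
      (\<forall>w\<in>tangent_space torus_sqrt2 (torus_point u v). ?g \<bullet> w = deriv_along torus_sqrt2 f (torus_point u v) w)"
  proof (intro conjI ballI)
    show "?g \<in> tangent_space torus_sqrt2 (torus_point u v)"
      by (simp add: tangent_space_torus inner_add_left frame_inner)
    fix w assume w: "w \<in> tangent_space torus_sqrt2 (torus_point u v)"
    then have "L w = L ((w \<bullet> e_lon u) *\<^sub>R e_lon u + (w \<bullet> e_lat u v) *\<^sub>R e_lat u v)"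
      using frame_expand[of w u v] by (simp add: tangent_space_torus)
    then show "?g \<bullet> w = deriv_along torus_sqrt2 f (torus_point u v) w"
      unfolding da[OF w] by (simp add: L.add L.scale inner_add_right inner_commute[of _ w])
  qed
  fix g assume g: "g \<in> tangent_space torus_sqrt2 (torus_point u v) \<and>
      (\<forall>w\<in>tangent_space torus_sqrt2 (torus_point u v). g \<bullet> w = deriv_along torus_sqrt2 f (torus_point u v) w)"
  then show "g = ?g"
    using frame_expand[of g u v] tan da by (simp add: tangent_space_torus)
qed

lemma orthonormal_basis_finite:
  fixes B :: "'a::euclidean_space set"
  assumes "orthonormal_basis_of V B" shows "finite B"
proof -
  have "0 \<notin> B" using assms by (force simp: orthonormal_basis_of_def)
  then show ?thesis
    using assms pairwise_orthogonal_independent independent_imp_finite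
    unfolding orthonormal_basis_of_def by blast
qed

text \<open>\<open>divergence\<close> sums over a basis picked by choice, so independence of the
  basis is needed. Expand each vector of B in C and exchange the sums; L may map V out of V, since
  only pairings with vectors of V occur.\<close>

lemma trace_orthonormal_basis:
  fixes L :: "'a::euclidean_space \<Rightarrow> 'a"
  assumes L: "linear L" and B: "orthonormal_basis_of V B" and C: "orthonormal_basis_of V C"
  shows "(\<Sum>e\<in>B. L e \<bullet> e) = (\<Sum>e\<in>C. L e \<bullet> e)"
proof -
  interpret L: linear L by (rule L)
  have fin: "finite B" "finite C" using B C orthonormal_basis_finite by blast+
  have expB: "(\<Sum>e\<in>B. (x \<bullet> e) *\<^sub>R e) = x" if "x \<in> V" for x
    using B fin that by (intro orthonormal_basis_expand) (auto simp: orthonormal_basis_of_def)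
  have expC: "(\<Sum>e\<in>C. (x \<bullet> e) *\<^sub>R e) = x" if "x \<in> V" for x
    using C fin that by (intro orthonormal_basis_expand) (auto simp: orthonormal_basis_of_def)
  have inV: "B \<subseteq> V" "C \<subseteq> V"
    using B C span_superset unfolding orthonormal_basis_of_def by blast+
  have "(\<Sum>e\<in>B. L e \<bullet> e) = (\<Sum>e\<in>B. \<Sum>c\<in>C. (e \<bullet> c) * (L c \<bullet> e))"
  proof (rule sum.cong[OF refl])
    fix e assume "e \<in> B"
    then have "L e = (\<Sum>c\<in>C. (e \<bullet> c) *\<^sub>R L c)"
      using expC[of e] inV by (metis (no_types, lifting) L.scale L.sum subsetD sum.cong)
    then show "L e \<bullet> e = (\<Sum>c\<in>C. (e \<bullet> c) * (L c \<bullet> e))"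
      by (simp add: inner_sum_left)
  qed
  also have "\<dots> = (\<Sum>c\<in>C. \<Sum>e\<in>B. (e \<bullet> c) * (L c \<bullet> e))" by (rule sum.swap)
  also have "\<dots> = (\<Sum>c\<in>C. L c \<bullet> c)"
  proof (rule sum.cong[OF refl])
    fix c assume "c \<in> C"
    then have "L c \<bullet> c = L c \<bullet> (\<Sum>e\<in>B. (c \<bullet> e) *\<^sub>R e)" using expB[of c] inV by auto
    then show "(\<Sum>e\<in>B. (e \<bullet> c) * (L c \<bullet> e)) = L c \<bullet> c"
      by (simp add: inner_sum_right inner_commute)
  qed
  finally show ?thesis .
qed

lemma orthonormal_basis_tangent_torus:
  "orthonormal_basis_of (tangent_space torus_sqrt2 (torus_point u v)) {e_lon u, e_lat u v}"
  unfolding orthonormal_basis_of_def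
proof (intro conjI)
  show "pairwise orthogonal {e_lon u, e_lat u v}"
    by (auto simp: pairwise_def orthogonal_def frame_inner inner_commute[of "e_lat u v" "e_lon u"])
  show "\<forall>e\<in>{e_lon u, e_lat u v}. norm e = 1" by (simp add: norm_eq_sqrt_inner frame_inner)
  show "span {e_lon u, e_lat u v} = tangent_space torus_sqrt2 (torus_point u v)"
  proof (intro equalityI subsetI)
    fix w assume "w \<in> span {e_lon u, e_lat u v}"
    then obtain a b where "w = a *\<^sub>R e_lon u + b *\<^sub>R e_lat u v"
      by (auto simp: span_insert algebra_simps)
    then show "w \<in> tangent_space torus_sqrt2 (torus_point u v)"
      by (simp add: tangent_space_torus inner_add_left frame_inner)
  next
    fix w assume "w \<in> tangent_space torus_sqrt2 (torus_point u v)"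
    then have "w = (w \<bullet> e_lon u) *\<^sub>R e_lon u + (w \<bullet> e_lat u v) *\<^sub>R e_lat u v"
      using frame_expand[of w u v] by (simp add: tangent_space_torus)
    then show "w \<in> span {e_lon u, e_lat u v}"
      by (metis insertI1 insertI2 span_add span_base span_scale)
  qed
qed

lemma divergence_torus:
  assumes d: "(G has_derivative L) (at (torus_point u v))"
    and U: "open U" "torus_point u v \<in> U" "\<And>q. q \<in> torus_sqrt2 \<inter> U \<Longrightarrow> G q = Y q"
  shows "divergence torus_sqrt2 Y (torus_point u v) = L (e_lon u) \<bullet> e_lon u + L (e_lat u v) \<bullet> e_lat u v"
proof -
  let ?T = "tangent_space torus_sqrt2 (torus_point u v)"
  define B where "B = (SOME B. orthonormal_basis_of ?T B)"
  have B: "orthonormal_basis_of ?T B"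
    unfolding B_def by (rule someI, rule orthonormal_basis_tangent_torus)
  \<comment> \<open>Projecting to the tangent plane does not change inner products with tangent
    vectors, so the covariant derivative may be replaced by the ambient one in the trace.\<close>
  have proj: "orth_proj ?T x \<bullet> e = x \<bullet> e" if e: "e \<in> ?T" for x e
  proof -
    have "orth_proj ?T x = x - (x \<bullet> e_nor u v) *\<^sub>R e_nor u v"
      unfolding orth_proj_def
    proof (rule the_equality)
      let ?w = "x - (x \<bullet> e_nor u v) *\<^sub>R e_nor u v"
      show w: "?w \<in> ?T \<and> (\<forall>z\<in>?T. (x - ?w) \<bullet> z = 0)"
        by (auto simp: tangent_space_torus inner_diff_left frame_inner inner_commute[of "e_nor u v"])
      fix y assume y: "y \<in> ?T \<and> (\<forall>z\<in>?T. (x - y) \<bullet> z = 0)"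
      have "y - ?w \<in> ?T" using y w by (simp add: tangent_space_torus inner_diff_left)
      then have "(x - y) \<bullet> (y - ?w) = 0" "(x - ?w) \<bullet> (y - ?w) = 0" using y w by blast+
      then have "(y - ?w) \<bullet> (y - ?w) = 0"
        by (metis (no_types, lifting) diff_diff_eq2 diff_add_cancel add_diff_cancel_left' diff_self inner_diff_left minus_diff_eq)
      then show "y = ?w" by simp
    qed
    then show ?thesis using e
      by (simp add: tangent_space_torus inner_diff_left inner_commute[of "e_nor u v"])
  qed
  have "divergence torus_sqrt2 Y (torus_point u v) = (\<Sum>e\<in>B. L e \<bullet> e)"
    unfolding divergence_def B_def[symmetric]
  proof (rule sum.cong[OF refl])
    fix e assume "e \<in> B"
    then have e: "e \<in> ?T" using B span_superset unfolding orthonormal_basis_of_def by blast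
    show "covariant_deriv torus_sqrt2 Y (torus_point u v) e \<bullet> e = L e \<bullet> e"
      using deriv_along_eqI[OF e d U] by (simp add: covariant_deriv_def proj[OF e])
  qed
  also have "\<dots> = (\<Sum>e\<in>{e_lon u, e_lat u v}. L e \<bullet> e)"
    by (rule trace_orthonormal_basis[OF has_derivative_linear[OF d] B orthonormal_basis_tangent_torus])
  also have "e_lon u \<noteq> e_lat u v" using frame_inner(1)[of u] frame_inner(4)[of u v] by auto
  then have "(\<Sum>e\<in>{e_lon u, e_lat u v}. L e \<bullet> e) = L (e_lon u) \<bullet> e_lon u + L (e_lat u v) \<bullet> e_lat u v"
    by simp
  finally show ?thesis .
qed

section \<open>The Laplacian in angular coordinates\<close>

definition pd :: "3 \<Rightarrow> (real^3 \<Rightarrow> real) \<Rightarrow> real^3 \<Rightarrow> real" where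
  "pd i F x = frechet_derivative F (at x) (axis i 1)"

lemma Ck_on_SucD:
  fixes F :: "real^3 \<Rightarrow> real"
  assumes "Ck_on (Suc n) F U"
  shows "x \<in> U \<Longrightarrow> F differentiable (at x)" "Ck_on n (pd i F) U"
  using assms by (auto simp: pd_def[abs_def] axis_in_Basis_iff)

lemma Ck_on_continuous:
  assumes "Ck_on n F U" shows "continuous_on U F"
proof (cases n)
  case 0 then show ?thesis using assms by simp
next
  case (Suc m)
  then have "\<And>x. x \<in> U \<Longrightarrow> F differentiable (at x)" using assms by simp
  then show ?thesis
    by (simp add: continuous_at_imp_continuous_on differentiable_imp_continuous_within)
qed

lemma has_derivative_pd:
  assumes "F differentiable (at x)"
  shows "(F has_derivative (\<lambda>w. \<Sum>i\<in>UNIV. w $ i * pd i F x)) (at x)"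
proof -
  have d: "(F has_derivative frechet_derivative F (at x)) (at x)"
    using assms frechet_derivative_works by blast
  interpret L: linear "frechet_derivative F (at x)" using d by (rule has_derivative_linear)
  have "frechet_derivative F (at x) w = (\<Sum>i\<in>UNIV. w $ i * pd i F x)" for w
  proof -
    have "w = (\<Sum>i\<in>UNIV. w $ i *\<^sub>R axis i 1)"
      using basis_expansion[of w] by (simp add: scalar_mult_eq_scaleR)
    then have "frechet_derivative F (at x) w = frechet_derivative F (at x) (\<Sum>i\<in>UNIV. w $ i *\<^sub>R axis i 1)"
      by (rule arg_cong)
    then show ?thesis by (simp add: L.sum L.scale pd_def)
  qed
  then have "frechet_derivative F (at x) = (\<lambda>w. \<Sum>i\<in>UNIV. w $ i * pd i F x)" by blast
  then show ?thesis using d by simp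
qed

lemma DERIV_pd_curve:
  assumes "F differentiable (at (c t))" "(c has_vector_derivative w) (at t)"
  shows "((\<lambda>t. F (c t)) has_real_derivative (\<Sum>i\<in>UNIV. w $ i * pd i F (c t))) (at t)"
  using vector_derivative_diff_chain_within[OF assms(2) has_derivative_at_withinI[OF has_derivative_pd[OF assms(1)]]]
  by (simp add: has_real_derivative_iff_has_vector_derivative o_def)

text \<open>The chain rule twice, for f known on S only. The derivatives are named by
  \<open>deriv\<close> because extensions F vary from point to point while f along c does not; the
  formulas in F later yield joint continuity.\<close>

lemma second_derivative_along_curve:
  assumes F: "Ck_on 2 F U" and U: "open U" "\<forall>q\<in>S \<inter> U. F q = f q"
    and c: "\<And>t. c t \<in> S" "\<And>t. (c has_vector_derivative y t) (at t)"
    and y: "\<And>t. (y has_vector_derivative z t) (at t)" and t: "c t \<in> U"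
  defines "g \<equiv> \<lambda>t. f (c t)"
  shows "(g has_real_derivative deriv g t) (at t)" "(deriv g has_real_derivative deriv (deriv g) t) (at t)"
    "deriv g t = (\<Sum>i\<in>UNIV. y t $ i * pd i F (c t))"
    "deriv (deriv g) t = (\<Sum>i\<in>UNIV. z t $ i * pd i F (c t) +
        y t $ i * (\<Sum>j\<in>UNIV. y t $ j * pd j (pd i F) (c t)))"
proof -
  define W where "W = {t. c t \<in> U}"
  have "continuous_on UNIV c"
    using c(2) has_vector_derivative_continuous by (metis continuous_at_imp_continuous_on)
  then have "open W" unfolding W_def using U(1) by (simp add: continuous_on_open_vimage vimage_def)
  have F2: "Ck_on (Suc (Suc 0)) F U" using F by (simp add: numeral_2_eq_2)
  define A where "A t = (\<Sum>i\<in>UNIV. y t $ i * pd i F (c t))" for t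
  have d1: "(g has_real_derivative A t) (at t)" if "t \<in> W" for t
  proof (rule has_field_derivative_transform_within_open[OF _ \<open>open W\<close> that])
    show "((\<lambda>t. F (c t)) has_real_derivative A t) (at t)"
      unfolding A_def using that by (intro DERIV_pd_curve c Ck_on_SucD[OF F2]) (simp add: W_def)
    show "F (c s) = g s" if "s \<in> W" for s using that U(2) c(1) by (simp add: W_def g_def)
  qed
  have dg: "deriv g s = A s" if "s \<in> W" for s using d1[OF that] by (rule DERIV_imp_deriv)
  have tW: "t \<in> W" using t by (simp add: W_def)
  let ?B = "\<Sum>i\<in>UNIV. z t $ i * pd i F (c t) + y t $ i * (\<Sum>j\<in>UNIV. y t $ j * pd j (pd i F) (c t))"
  have "(A has_real_derivative ?B) (at t)"
    unfolding A_def
  proof (rule DERIV_sum)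
    fix i :: 3
    have "((\<lambda>t. y t $ i) has_real_derivative z t $ i) (at t)"
      using bounded_linear.has_vector_derivative[OF bounded_linear_vec_nth y]
      by (simp add: has_real_derivative_iff_has_vector_derivative)
    moreover have "((\<lambda>t. pd i F (c t)) has_real_derivative (\<Sum>j\<in>UNIV. y t $ j * pd j (pd i F) (c t))) (at t)"
      using t by (intro DERIV_pd_curve c Ck_on_SucD(1)[OF Ck_on_SucD(2)[OF F2]])
    ultimately show "((\<lambda>t. y t $ i * pd i F (c t)) has_real_derivative
        z t $ i * pd i F (c t) + y t $ i * (\<Sum>j\<in>UNIV. y t $ j * pd j (pd i F) (c t))) (at t)"
      by (rule field_derivative_eqI[OF DERIV_mult]) simp
  qed
  then have d2: "(deriv g has_real_derivative ?B) (at t)"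
    by (rule has_field_derivative_transform_within_open[OF _ \<open>open W\<close> tW]) (simp add: dg)
  show "(g has_real_derivative deriv g t) (at t)" using d1[OF tW] dg[OF tW] by simp
  show "deriv g t = (\<Sum>i\<in>UNIV. y t $ i * pd i F (c t))" using dg[OF tW] by (simp add: A_def)
  show "deriv (deriv g) t = ?B" using d2 by (rule DERIV_imp_deriv)
  then show "(deriv g has_real_derivative deriv (deriv g) t) (at t)" using d2 by simp
qed

definition du :: "(real^3 \<Rightarrow> real) \<Rightarrow> real \<Rightarrow> real \<Rightarrow> real" where
  "du f u v = deriv (\<lambda>u. f (torus_point u v)) u"
definition duu :: "(real^3 \<Rightarrow> real) \<Rightarrow> real \<Rightarrow> real \<Rightarrow> real" where
  "duu f u v = deriv (deriv (\<lambda>u. f (torus_point u v))) u"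
definition dv :: "(real^3 \<Rightarrow> real) \<Rightarrow> real \<Rightarrow> real \<Rightarrow> real" where
  "dv f u v = deriv (\<lambda>v. f (torus_point u v)) v"
definition dvv :: "(real^3 \<Rightarrow> real) \<Rightarrow> real \<Rightarrow> real \<Rightarrow> real" where
  "dvv f u v = deriv (deriv (\<lambda>v. f (torus_point u v))) v"

lemma frame_derivatives':
  "((\<lambda>u. rad v *\<^sub>R e_lon u) has_vector_derivative - (rad v *\<^sub>R e_rad u)) (at u)"
  using has_vector_derivative_scaleR[OF DERIV_const[of "rad v"] frame_derivatives(3)[of u]] by simp

lemma torus_partials:
  assumes F: "Ck_on 2 F U" and U: "open U" "\<forall>q\<in>torus_sqrt2 \<inter> U. F q = f q"
    and t: "torus_point u v \<in> U"
  shows "((\<lambda>u. f (torus_point u v)) has_real_derivative du f u v) (at u)"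
    "((\<lambda>u. du f u v) has_real_derivative duu f u v) (at u)"
    "((\<lambda>v. f (torus_point u v)) has_real_derivative dv f u v) (at v)"
    "((\<lambda>v. dv f u v) has_real_derivative dvv f u v) (at v)"
    "du f u v = (\<Sum>i\<in>UNIV. (rad v *\<^sub>R e_lon u) $ i * pd i F (torus_point u v))"
    "duu f u v = (\<Sum>i\<in>UNIV. (- (rad v *\<^sub>R e_rad u)) $ i * pd i F (torus_point u v) +
        (rad v *\<^sub>R e_lon u) $ i * (\<Sum>j\<in>UNIV. (rad v *\<^sub>R e_lon u) $ j * pd j (pd i F) (torus_point u v)))"
    "dv f u v = (\<Sum>i\<in>UNIV. e_lat u v $ i * pd i F (torus_point u v))"
    "dvv f u v = (\<Sum>i\<in>UNIV. (- e_nor u v) $ i * pd i F (torus_point u v) +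
        e_lat u v $ i * (\<Sum>j\<in>UNIV. e_lat u v $ j * pd j (pd i F) (torus_point u v)))"
proof -
  note * = second_derivative_along_curve[where c = "\<lambda>u. torus_point u v" and y = "\<lambda>u. rad v *\<^sub>R e_lon u"
      and z = "\<lambda>u. - (rad v *\<^sub>R e_rad u)", OF F U torus_point_in frame_derivatives(1) frame_derivatives' t]
  note ** = second_derivative_along_curve[where c = "\<lambda>v. torus_point u v" and y = "e_lat u"
      and z = "\<lambda>v. - e_nor u v", OF F U torus_point_in frame_derivatives(2) frame_derivatives(4) t]
  show "((\<lambda>u. f (torus_point u v)) has_real_derivative du f u v) (at u)"
    "((\<lambda>u. du f u v) has_real_derivative duu f u v) (at u)"
    "du f u v = (\<Sum>i\<in>UNIV. (rad v *\<^sub>R e_lon u) $ i * pd i F (torus_point u v))"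
    "duu f u v = (\<Sum>i\<in>UNIV. (- (rad v *\<^sub>R e_rad u)) $ i * pd i F (torus_point u v) +
        (rad v *\<^sub>R e_lon u) $ i * (\<Sum>j\<in>UNIV. (rad v *\<^sub>R e_lon u) $ j * pd j (pd i F) (torus_point u v)))"
    unfolding du_def duu_def by (rule *)+
  show "((\<lambda>v. f (torus_point u v)) has_real_derivative dv f u v) (at v)"
    "((\<lambda>v. dv f u v) has_real_derivative dvv f u v) (at v)"
    "dv f u v = (\<Sum>i\<in>UNIV. e_lat u v $ i * pd i F (torus_point u v))"
    "dvv f u v = (\<Sum>i\<in>UNIV. (- e_nor u v) $ i * pd i F (torus_point u v) +
        e_lat u v $ i * (\<Sum>j\<in>UNIV. e_lat u v $ j * pd j (pd i F) (torus_point u v)))"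
    unfolding dv_def dvv_def by (rule **)+
qed

lemma continuous_on_vector_3 [continuous_intros]:
  assumes "continuous_on s f" "continuous_on s g" "continuous_on s h"
  shows "continuous_on s (\<lambda>t. vector [f t, g t, h t] :: real^3)"
proof -
  have e: "vector [a, b, c] = a *\<^sub>R axis 1 1 + b *\<^sub>R axis 2 1 + c *\<^sub>R (axis 3 1 :: real^3)" for a b c :: real
    by (simp add: vec_eq_3 axis_def)
  show ?thesis unfolding e by (intro continuous_intros assms)
qed

lemma continuous_on_frame:
  fixes s :: "(real \<times> real) set"
  shows "continuous_on s (\<lambda>p. torus_point (fst p) (snd p))" "continuous_on s (\<lambda>p. e_lon (fst p))"
    "continuous_on s (\<lambda>p. e_rad (fst p))" "continuous_on s (\<lambda>p. e_lat (fst p) (snd p))"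
    "continuous_on s (\<lambda>p. e_nor (fst p) (snd p))"
  unfolding frame_defs by (intro continuous_intros)+

lemma smooth_function_on_local:
  assumes "smooth_function_on S f" "p \<in> S"
  obtains U F where "open U" "p \<in> U" "\<And>n. Ck_on n F U" "\<forall>q\<in>S \<inter> U. F q = f q"
  using assms unfolding smooth_function_on_def smooth_on_open_def by blast

text \<open>Continuity is local: near each parameter pair one extension F is valid, and there the
  derivatives are continuous expressions in the partials of F and the frame.\<close>

lemma second_partials_torus:
  assumes f: "smooth_function_on torus_sqrt2 f"
  shows "second_partials (\<lambda>u v. f (torus_point u v)) (du f) (duu f) (dv f) (dvv f)"
proof -
  have loc: "((\<lambda>u. f (torus_point u v)) has_real_derivative du f u v) (at u) \<and>
    ((\<lambda>u. du f u v) has_real_derivative duu f u v) (at u) \<and>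
    ((\<lambda>v. f (torus_point u v)) has_real_derivative dv f u v) (at v) \<and>
    ((\<lambda>v. dv f u v) has_real_derivative dvv f u v) (at v) \<and>
    (\<forall>g \<in> {\<lambda>u v. f (torus_point u v), du f, duu f, dv f, dvv f}. isCont (\<lambda>p. g (fst p) (snd p)) (u, v))" for u v
  proof -
    obtain U F where U: "open U" "torus_point u v \<in> U" "\<And>n. Ck_on n F U" "\<forall>q\<in>torus_sqrt2 \<inter> U. F q = f q"
      using smooth_function_on_local[OF f torus_point_in] by metis
    define W where "W = {p. torus_point (fst p) (snd p) \<in> U}"
    have "open W" unfolding W_def
      using continuous_on_frame(1)[of UNIV] U(1) by (simp add: continuous_on_open_vimage vimage_def)
    have W: "(u, v) \<in> W" using U by (simp add: W_def)
    note tp = torus_partials[OF U(3) U(1,4)]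
    have c1: "continuous_on W (\<lambda>p. k (torus_point (fst p) (snd p)))" if "continuous_on U k" for k :: "real^3 \<Rightarrow> real"
      by (rule continuous_on_compose2[OF that continuous_on_frame(1)]) (auto simp: W_def)
    have F2: "Ck_on (Suc (Suc 0)) F U" by (rule U)
    have cF: "continuous_on W (\<lambda>p. F (torus_point (fst p) (snd p)))"
      "continuous_on W (\<lambda>p. pd i F (torus_point (fst p) (snd p)))"
      "continuous_on W (\<lambda>p. pd j (pd i F) (torus_point (fst p) (snd p)))" for i j
      by (intro c1 Ck_on_continuous, rule U Ck_on_SucD(2)[OF U(3)] Ck_on_SucD(2)[OF Ck_on_SucD(2)[OF F2]])+
    have cv: "continuous_on W (\<lambda>p. rad (snd p))" by (intro continuous_intros)
    note ci = continuous_on_sum continuous_on_mult continuous_on_add continuous_on_minus continuous_on_scaleR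
      continuous_on_component cF continuous_on_frame cv
    have isC: "isCont (\<lambda>p. g (fst p) (snd p)) (u, v)"
      if "continuous_on W k" "\<And>p. p \<in> W \<Longrightarrow> g (fst p) (snd p) = k p" for g :: "real \<Rightarrow> real \<Rightarrow> real" and k
    proof -
      have "continuous_on W (\<lambda>p. g (fst p) (snd p))" using that by (simp cong: continuous_on_cong)
      then show ?thesis using \<open>open W\<close> W by (simp add: continuous_on_eq_continuous_at)
    qed
    have "isCont (\<lambda>p. f (torus_point (fst p) (snd p))) (u, v)"
      by (rule isC[OF cF(1)]) (simp add: W_def U)
    moreover have "isCont (\<lambda>p. du f (fst p) (snd p)) (u, v)"
      by (rule isC[OF _ tp(5)], intro ci, simp_all add: W_def)
    moreover have "isCont (\<lambda>p. duu f (fst p) (snd p)) (u, v)"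
      by (rule isC[OF _ tp(6)], intro ci, simp_all add: W_def)
    moreover have "isCont (\<lambda>p. dv f (fst p) (snd p)) (u, v)"
      by (rule isC[OF _ tp(7)], intro ci, simp_all add: W_def)
    moreover have "isCont (\<lambda>p. dvv f (fst p) (snd p)) (u, v)"
      by (rule isC[OF _ tp(8)], intro ci, simp_all add: W_def)
    ultimately show ?thesis using tp(1-4)[OF U(2)] by blast
  qed
  show ?thesis unfolding second_partials_def
    using loc by (auto intro!: continuous_at_imp_continuous_on)
qed

text \<open>The gradient is extended to an ambient field G by projecting the gradient of F off an
  extended normal. Differentiating the frame components of G along coordinate curves gives the
  trace. The first-order term arises because \<open>e_lon\<close> turns along a parallel, its
  derivative - \<open>e_rad\<close> having the \<open>e_lat\<close> component sin v.\<close>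

lemma laplacian_torus:
  assumes f: "smooth_function_on torus_sqrt2 f"
  shows "laplacian torus_sqrt2 f (torus_point u v) =
    duu f u v / (rad v)\<^sup>2 + dvv f u v - sin v / rad v * dv f u v"
proof -
  obtain U0 F where U0: "open U0" "torus_point u v \<in> U0" "\<And>n. Ck_on n F U0" "\<forall>q\<in>torus_sqrt2 \<inter> U0. F q = f q"
    using smooth_function_on_local[OF f torus_point_in] by metis
  define rho where "rho q = sqrt ((q$1)\<^sup>2 + (q$2)\<^sup>2)" for q :: "real^3"
  \<comment> \<open>The axis is removed, since the distance from it is not differentiable
    there.\<close>
  define U where "U = U0 \<inter> {q. 0 < (q$1)\<^sup>2 + (q$2)\<^sup>2}"
  have "open U" unfolding U_def
    by (intro open_Int U0 open_Collect_less continuous_intros)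
  note sq = torus_point_radius_sq
  have rho: "rho (torus_point a b) = rad b" for a b by (simp add: rho_def sq)
  have inU: "torus_point a b \<in> U \<longleftrightarrow> torus_point a b \<in> U0" for a b by (simp add: U_def sq)
  have pU: "torus_point u v \<in> U" using U0 inU by simp
  define D where "D q = (\<Sum>i\<in>UNIV. pd i F q *\<^sub>R axis i 1 :: real^3)" for q
  have D_inner: "D q \<bullet> w = (\<Sum>i\<in>UNIV. w $ i * pd i F q)" for q w
    by (simp add: D_def inner_sum_left inner_axis' mult.commute)
  \<comment> \<open>The vector from the nearest point of the core circle of radius sqrt 2 to q,
    which is the unit normal on the torus.\<close>
  define N where "N q = (1 - sqrt 2 / rho q) *\<^sub>R (q$1 *\<^sub>R axis 1 1 + q$2 *\<^sub>R axis 2 1) + q$3 *\<^sub>R (axis 3 1 :: real^3)" for q :: "real^3"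
  have N: "N (torus_point a b) = e_nor a b" for a b
  proof -
    have "(1 - sqrt 2 / rad b) * (rad b * x) = cos b * x" for x
    proof -
      have "(1 - sqrt 2 / rad b) * (rad b * x) = (rad b - sqrt 2) * x" by (simp add: field_simps)
      then show ?thesis by (simp add: rad_def)
    qed
    then show ?thesis unfolding N_def rho by (simp add: vec_eq_3 frame_defs axis_def)
  qed
  define G where "G q = D q - (D q \<bullet> N q) *\<^sub>R N q" for q
  have grad: "gradient torus_sqrt2 f (torus_point a b) =
      (D (torus_point a b) \<bullet> e_lon a) *\<^sub>R e_lon a + (D (torus_point a b) \<bullet> e_lat a b) *\<^sub>R e_lat a b"
    if "torus_point a b \<in> U" for a b
    unfolding D_inner
  proof (rule gradient_torus[OF has_derivative_pd U0(1)])
    show "F differentiable at (torus_point a b)"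
      using Ck_on_SucD(1)[OF U0(3)] that inU by blast
  qed (use that inU U0(4) in auto)
  have G_grad: "G (torus_point a b) = gradient torus_sqrt2 f (torus_point a b)"
    if "torus_point a b \<in> U" for a b
    unfolding grad[OF that] G_def N
    using frame_expand[of "D (torus_point a b)" a b] by (metis add_diff_cancel_right')
  have Gd: "G differentiable (at (torus_point u v))"
  proof -
    have dpd: "pd i F differentiable (at (torus_point u v))" for i
      by (rule Ck_on_SucD(1)[OF Ck_on_SucD(2)[OF U0(3)] U0(2)])
    have dD: "D differentiable (at (torus_point u v))"
      unfolding D_def[abs_def] by (intro differentiable_sum ballI differentiable_scaleR dpd differentiable_const) simp_all
    have nth: "(\<lambda>q. q $ i) differentiable (at (torus_point u v))" for i :: 3
      by (intro bounded_linear_imp_differentiable bounded_linear_vec_nth)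
    have "((\<lambda>t. sqrt t) has_real_derivative inverse (sqrt ((rad v)\<^sup>2)) / 2) (at ((rad v)\<^sup>2))"
      by (rule DERIV_real_sqrt) simp
    then have "sqrt differentiable (at ((torus_point u v $ 1)\<^sup>2 + (torus_point u v $ 2)\<^sup>2))"
      unfolding sq using real_differentiable_def by blast
    then have "(sqrt \<circ> (\<lambda>q. (q$1)\<^sup>2 + (q$2)\<^sup>2)) differentiable (at (torus_point u v))"
      by (intro differentiable_chain_at differentiable_add differentiable_power nth)
    then have "rho differentiable (at (torus_point u v))" by (simp add: rho_def[abs_def] o_def)
    then have "(\<lambda>q. 1 - sqrt 2 / rho q) differentiable (at (torus_point u v))"
      by (intro differentiable_diff differentiable_divide) (auto simp: rho)
    then have dN: "N differentiable (at (torus_point u v))"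
      unfolding N_def[abs_def] by (intro differentiable_add differentiable_scaleR nth) auto
    show ?thesis unfolding G_def[abs_def]
      by (intro differentiable_diff differentiable_scaleR differentiable_inner dD dN)
  qed
  then obtain L where L: "(G has_derivative L) (at (torus_point u v))" by (auto simp: differentiable_def)
  have lap: "laplacian torus_sqrt2 f (torus_point u v) = L (e_lon u) \<bullet> e_lon u + L (e_lat u v) \<bullet> e_lat u v"
    unfolding laplacian_def
  proof (rule divergence_torus[OF L \<open>open U\<close> pU])
    fix q assume q: "q \<in> torus_sqrt2 \<inter> U"
    then obtain a b where "q = torus_point a b" using torus_point_exists by blast
    then show "G q = gradient torus_sqrt2 f q" using q G_grad by simp
  qed
  note tp = torus_partials[OF U0(3) U0(1,4)]
  \<comment> \<open>The factor 1/r appears because the coordinate vector along u has length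
    r.\<close>
  have Glon: "G (torus_point a b) \<bullet> e_lon a = du f a b / rad b" if "torus_point a b \<in> U" for a b
    using that tp(5)[of a b] inU unfolding G_grad[OF that] grad[OF that]
    by (simp add: inner_add_left frame_inner inner_commute[of "e_lat a b" "e_lon a"] D_inner mult.assoc sum_distrib_left[symmetric])
  have Glat: "G (torus_point a b) \<bullet> e_lat a b = dv f a b" if "torus_point a b \<in> U" for a b
    using that tp(7)[of a b] inU unfolding G_grad[OF that] grad[OF that]
    by (simp add: inner_add_left frame_inner D_inner)
  have Gnor: "G (torus_point u v) \<bullet> e_nor u v = 0"
    unfolding G_grad[OF pU] grad[OF pU] by (simp add: inner_add_left frame_inner)
  have Grad: "G (torus_point u v) \<bullet> e_rad u = - sin v * dv f u v"
    using Glat[OF pU] unfolding G_grad[OF pU] grad[OF pU]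
    by (simp add: inner_add_left frame_inner inner_commute[of "e_lon u" "e_rad u"] inner_commute[of "e_lat u v" "e_rad u"])
  have Lc: "((\<lambda>t. G (c t)) has_vector_derivative L w) (at t)"
    if "(c has_vector_derivative w) (at t)" "c t = torus_point u v" for c w t
    using vector_derivative_diff_chain_within[OF that(1), of G L] L that(2)
    by (simp add: o_def has_derivative_at_withinI)
  have cont: "continuous_on UNIV (\<lambda>t. torus_point u t)" "continuous_on UNIV (\<lambda>t. torus_point t v)"
    unfolding torus_point_def by (intro continuous_intros)+
  have opens: "open {t. torus_point u t \<in> U}" "open {t. torus_point t v \<in> U}"
    using cont \<open>open U\<close> by (simp_all add: continuous_on_open_vimage vimage_def)
  have lat: "L (e_lat u v) \<bullet> e_lat u v = dvv f u v"
  proof -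
    have "((\<lambda>t. G (torus_point u t) \<bullet> e_lat u t) has_vector_derivative
        G (torus_point u v) \<bullet> - e_nor u v + L (e_lat u v) \<bullet> e_lat u v) (at v)"
      by (intro bounded_bilinear.has_vector_derivative[OF bounded_bilinear_inner] Lc frame_derivatives refl)
    then have "((\<lambda>t. G (torus_point u t) \<bullet> e_lat u t) has_real_derivative L (e_lat u v) \<bullet> e_lat u v) (at v)"
      using Gnor by (simp add: has_real_derivative_iff_has_vector_derivative)
    then have "((\<lambda>t. dv f u t) has_real_derivative L (e_lat u v) \<bullet> e_lat u v) (at v)"
      by (rule has_field_derivative_transform_within_open[OF _ opens(1)]) (use pU Glat in auto)
    then show ?thesis using tp(4)[OF U0(2)] by (rule DERIV_unique)
  qed
  have lon: "rad v * (L (e_lon u) \<bullet> e_lon u) = duu f u v / rad v - sin v * dv f u v"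
  proof -
    have "((\<lambda>t. G (torus_point t v) \<bullet> e_lon t) has_vector_derivative
        G (torus_point u v) \<bullet> - e_rad u + L (rad v *\<^sub>R e_lon u) \<bullet> e_lon u) (at u)"
      by (intro bounded_bilinear.has_vector_derivative[OF bounded_bilinear_inner] Lc frame_derivatives refl)
    moreover have "L (rad v *\<^sub>R e_lon u) = rad v *\<^sub>R L (e_lon u)"
      using has_derivative_linear[OF L] by (simp add: linear_cmul)
    ultimately have "((\<lambda>t. G (torus_point t v) \<bullet> e_lon t) has_real_derivative
        sin v * dv f u v + rad v * (L (e_lon u) \<bullet> e_lon u)) (at u)"
      using Grad by (simp add: has_real_derivative_iff_has_vector_derivative)
    then have "((\<lambda>t. du f t v / rad v) has_real_derivative
        sin v * dv f u v + rad v * (L (e_lon u) \<bullet> e_lon u)) (at u)"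
      by (rule has_field_derivative_transform_within_open[OF _ opens(2)]) (use pU Glon in auto)
    moreover have "((\<lambda>t. du f t v / rad v) has_real_derivative duu f u v / rad v) (at u)"
      using tp(2)[OF U0(2)] by (rule DERIV_cdivide)
    ultimately have "sin v * dv f u v + rad v * (L (e_lon u) \<bullet> e_lon u) = duu f u v / rad v"
      by (rule DERIV_unique)
    then show ?thesis by simp
  qed
  have "L (e_lon u) \<bullet> e_lon u = (duu f u v / rad v - sin v * dv f u v) / rad v"
    unfolding lon[symmetric] by simp
  then show ?thesis unfolding lap lat
    by (simp add: diff_divide_distrib power2_eq_square)
qed

section \<open>Smoothness of the first mode\<close>

lemma Ck_on_cong:
  assumes "open U" "\<And>x. x \<in> U \<Longrightarrow> F x = G x" "Ck_on n F U"
  shows "Ck_on n G U"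
  using assms(2,3)
proof (induction n arbitrary: F G)
  case 0
  then show ?case using continuous_on_cong[of U U F G] by simp
next
  case (Suc n)
  have d: "(G has_derivative frechet_derivative F (at x)) (at x)" if "x \<in> U" for x
  proof (rule has_derivative_transform_within_open[OF _ assms(1) that])
    show "(F has_derivative frechet_derivative F (at x)) (at x)"
      using Suc.prems(2) that frechet_derivative_works by auto
  qed (use Suc.prems(1) in auto)
  have "Ck_on n (\<lambda>x. frechet_derivative G (at x) b) U" if "b \<in> Basis" for b
  proof (rule Suc.IH)
    show "Ck_on n (\<lambda>x. frechet_derivative F (at x) b) U" using Suc.prems(2) that by simp
    show "frechet_derivative F (at x) b = frechet_derivative G (at x) b" if "x \<in> U" for x
      using frechet_derivative_at[OF d[OF that]] by simp
  qed
  then show ?case using d by (auto simp: differentiable_def)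
qed

lemma Ck_on_SucI:
  assumes "open U" and d: "\<And>x. x \<in> U \<Longrightarrow> (F has_derivative D x) (at x)"
    and c: "\<And>b. b \<in> Basis \<Longrightarrow> Ck_on n (\<lambda>x. D x b) U"
  shows "Ck_on (Suc n) F U"
proof -
  have "Ck_on n (\<lambda>x. frechet_derivative F (at x) b) U" if "b \<in> Basis" for b
    by (rule Ck_on_cong[OF assms(1) _ c[OF that]]) (use frechet_derivative_at[OF d] in simp)
  then show ?thesis using d by (auto simp: differentiable_def)
qed

lemma Ck_on_SucD':
  assumes "Ck_on (Suc n) F U"
  shows "x \<in> U \<Longrightarrow> (F has_derivative frechet_derivative F (at x)) (at x)"
    "b \<in> Basis \<Longrightarrow> Ck_on n (\<lambda>x. frechet_derivative F (at x) b) U"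
  using assms frechet_derivative_works by auto

text \<open>Serves the product rule, where the undifferentiated factors must be lowered by one order
  for the induction.\<close>

lemma Ck_on_Suc_imp: "Ck_on (Suc n) F U \<Longrightarrow> Ck_on n F U"
proof (induction n arbitrary: F)
  case 0
  then show ?case
    by (simp add: continuous_at_imp_continuous_on differentiable_imp_continuous_within)
qed auto

lemma Ck_on_const: "open U \<Longrightarrow> Ck_on n (\<lambda>_. c) U"
proof (induction n arbitrary: c)
  case (Suc n)
  show ?case by (rule Ck_on_SucI[OF Suc.prems has_derivative_const]) (rule Suc.IH[OF Suc.prems])
qed simp

lemma Ck_on_linear:
  assumes "open U" "bounded_linear F" shows "Ck_on n F U"
proof (cases n)
  case 0 then show ?thesis using linear_continuous_on[OF assms(2)] by simp
next
  case (Suc m)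
  then show ?thesis
    by (simp only:) (rule Ck_on_SucI[OF assms(1) bounded_linear_imp_has_derivative[OF assms(2)] Ck_on_const[OF assms(1)]])
qed

lemma Ck_on_add:
  assumes "open U" shows "Ck_on n F U \<Longrightarrow> Ck_on n G U \<Longrightarrow> Ck_on n (\<lambda>x. F x + G x) U"
proof (induction n arbitrary: F G)
  case 0 then show ?case by (simp add: continuous_on_add)
next
  case (Suc n)
  show ?case
    by (rule Ck_on_SucI[OF assms has_derivative_add[OF Ck_on_SucD'(1)[OF Suc.prems(1)] Ck_on_SucD'(1)[OF Suc.prems(2)]]])
      (auto intro: Suc.IH Ck_on_SucD'(2)[OF Suc.prems(1)] Ck_on_SucD'(2)[OF Suc.prems(2)])
qed

lemma Ck_on_mult:
  fixes F G :: "'a::euclidean_space \<Rightarrow> real"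
  assumes "open U" shows "Ck_on n F U \<Longrightarrow> Ck_on n G U \<Longrightarrow> Ck_on n (\<lambda>x. F x * G x) U"
proof (induction n arbitrary: F G)
  case 0 then show ?case by (simp add: continuous_on_mult)
next
  case (Suc n)
  note FG = Ck_on_Suc_imp[OF Suc.prems(1)] Ck_on_Suc_imp[OF Suc.prems(2)]
  show ?case
    by (rule Ck_on_SucI[OF assms has_derivative_mult[OF Ck_on_SucD'(1)[OF Suc.prems(1)] Ck_on_SucD'(1)[OF Suc.prems(2)]]])
      (auto intro!: Suc.IH Ck_on_add assms FG Ck_on_SucD'(2)[OF Suc.prems(1)] Ck_on_SucD'(2)[OF Suc.prems(2)])
qed

text \<open>Gains one order. If h' is built from h and smooth functions, order n for h gives order n
  for h', hence order n + 1 for h, and induction reaches every order.\<close>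

lemma Ck_on_chain:
  assumes U: "open U" and h: "\<And>x. x \<in> U \<Longrightarrow> (h has_real_derivative h' (F x)) (at (F x))"
    and F: "Ck_on (Suc n) F U" and h': "Ck_on n (\<lambda>x. h' (F x)) U"
  shows "Ck_on (Suc n) (\<lambda>x. h (F x)) U"
proof (rule Ck_on_SucI[OF U])
  fix x assume "x \<in> U"
  from has_derivative_compose[OF Ck_on_SucD'(1)[OF F this] h[OF this, unfolded has_field_derivative_def]]
  show "((\<lambda>x. h (F x)) has_derivative (\<lambda>w. h' (F x) * frechet_derivative F (at x) w)) (at x)" .
next
  fix b :: 'a assume "b \<in> Basis"
  then show "Ck_on n (\<lambda>x. h' (F x) * frechet_derivative F (at x) b) U"
    by (intro Ck_on_mult U h' Ck_on_SucD'(2)[OF F])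
qed

lemma smooth_on_openI:
  assumes "continuous_on U F" "\<And>n. Ck_on n F U \<Longrightarrow> Ck_on (Suc n) F U"
  shows "smooth_on_open F U"
proof -
  have "Ck_on n F U" for n by (induction n) (use assms in auto)
  then show ?thesis by (simp add: smooth_on_open_def)
qed

lemma smooth_on_open_continuous: "smooth_on_open F U \<Longrightarrow> continuous_on U F"
  unfolding smooth_on_open_def by (metis Ck_on.simps(1))

lemma smooth_on_open_const: "open U \<Longrightarrow> smooth_on_open (\<lambda>_. c) U"
  by (simp add: smooth_on_open_def Ck_on_const)

lemma smooth_on_open_linear: "open U \<Longrightarrow> bounded_linear F \<Longrightarrow> smooth_on_open F U"
  by (simp add: smooth_on_open_def Ck_on_linear)

lemma smooth_on_open_add:
  "open U \<Longrightarrow> smooth_on_open F U \<Longrightarrow> smooth_on_open G U \<Longrightarrow> smooth_on_open (\<lambda>x. F x + G x) U"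
  by (simp add: smooth_on_open_def Ck_on_add)

lemma smooth_on_open_mult:
  "open U \<Longrightarrow> smooth_on_open F U \<Longrightarrow> smooth_on_open G U \<Longrightarrow> smooth_on_open (\<lambda>x. F x * G x) U"
  by (simp add: smooth_on_open_def Ck_on_mult)

lemma smooth_on_open_inverse:
  assumes U: "open U" and F: "smooth_on_open F U" and nz: "\<And>x. x \<in> U \<Longrightarrow> F x \<noteq> 0"
  shows "smooth_on_open (\<lambda>x. inverse (F x)) U"
proof (rule smooth_on_openI)
  show "continuous_on U (\<lambda>x. inverse (F x))"
    using smooth_on_open_continuous[OF F] nz by (intro continuous_intros) auto
  fix n assume IH: "Ck_on n (\<lambda>x. inverse (F x)) U"
  show "Ck_on (Suc n) (\<lambda>x. inverse (F x)) U"
  proof (rule Ck_on_chain[OF U, where h = inverse and F = F and h' = "\<lambda>t. -1 * (inverse t * inverse t)"])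
    show "(inverse has_real_derivative - 1 * (inverse (F x) * inverse (F x))) (at (F x))" if "x \<in> U" for x
      using DERIV_inverse[OF nz[OF that]] by (simp add: power2_eq_square numeral_2_eq_2)
    show "Ck_on (Suc n) F U" using F by (auto simp: smooth_on_open_def simp del: Ck_on.simps)
    show "Ck_on n (\<lambda>x. - 1 * (inverse (F x) * inverse (F x))) U"
      by (intro Ck_on_mult U IH Ck_on_const)
  qed
qed

lemma smooth_on_open_sqrt:
  assumes U: "open U" and F: "smooth_on_open F U" and pos: "\<And>x. x \<in> U \<Longrightarrow> 0 < F x"
  shows "smooth_on_open (\<lambda>x. sqrt (F x)) U"
proof -
  have inv: "smooth_on_open (\<lambda>x. inverse (F x)) U"
    using pos by (intro smooth_on_open_inverse U F) (metis less_irrefl)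
  show ?thesis
  proof (rule smooth_on_openI)
    show "continuous_on U (\<lambda>x. sqrt (F x))"
      using smooth_on_open_continuous[OF F] by (intro continuous_intros)
    fix n assume IH: "Ck_on n (\<lambda>x. sqrt (F x)) U"
    \<comment> \<open>The derivative is written as sqrt t / (2 t), so that it contains the root
      itself and the induction hypothesis applies.\<close>
    have "Ck_on n (\<lambda>x. 1/2 * (sqrt (F x) * inverse (F x))) U"
      using inv by (intro Ck_on_mult U IH Ck_on_const) (simp add: smooth_on_open_def)
    moreover have "(sqrt has_real_derivative 1/2 * (sqrt (F x) * inverse (F x))) (at (F x))" if "x \<in> U" for x
    proof (rule field_derivative_eqI[OF DERIV_real_sqrt[OF pos[OF that]]])
      have "sqrt (F x) * sqrt (F x) = F x" using pos[OF that] by simp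
      then show "inverse (sqrt (F x)) / 2 = 1/2 * (sqrt (F x) * inverse (F x))"
        using pos[OF that] by (simp add: field_simps)
    qed
    moreover have "Ck_on (Suc n) F U" using F by (auto simp: smooth_on_open_def simp del: Ck_on.simps)
    ultimately show "Ck_on (Suc n) (\<lambda>x. sqrt (F x)) U"
      by (intro Ck_on_chain[OF U, where h = sqrt and F = F and h' = "\<lambda>t. 1/2 * (sqrt t * inverse t)"])
  qed
qed

lemma smooth_on_open_arctan:
  assumes U: "open U" and F: "smooth_on_open F U"
  shows "smooth_on_open (\<lambda>x. arctan (F x)) U"
proof (rule smooth_on_openI)
  show "continuous_on U (\<lambda>x. arctan (F x))"
    using smooth_on_open_continuous[OF F] by (intro continuous_intros)
  have "smooth_on_open (\<lambda>x. inverse (1 + F x * F x)) U"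
    by (intro smooth_on_open_inverse smooth_on_open_add smooth_on_open_mult smooth_on_open_const U F)
      (metis add_pos_nonneg less_irrefl zero_le_square zero_less_one)
  then have h': "Ck_on n (\<lambda>x. inverse (1 + F x * F x)) U" for n by (simp add: smooth_on_open_def)
  show "Ck_on (Suc n) (\<lambda>x. arctan (F x)) U" for n
  proof (rule Ck_on_chain[OF U, where h = arctan and F = F and h' = "\<lambda>t. inverse (1 + t * t)"])
    show "(arctan has_real_derivative inverse (1 + F x * F x)) (at (F x))" for x
      using DERIV_arctan[of "F x"] by (simp add: power2_eq_square)
    show "Ck_on (Suc n) F U" using F by (auto simp: smooth_on_open_def simp del: Ck_on.simps)
  qed (rule h')
qed

lemma smooth_on_open_sin_cos:
  assumes U: "open U" and F: "smooth_on_open F U"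
  shows "smooth_on_open (\<lambda>x. sin (F x)) U" "smooth_on_open (\<lambda>x. cos (F x)) U"
proof -
  have c: "continuous_on U F" by (rule smooth_on_open_continuous[OF F])
  have FS: "Ck_on n F U" for n using F by (simp add: smooth_on_open_def)
  have "Ck_on n (\<lambda>x. sin (F x)) U \<and> Ck_on n (\<lambda>x. cos (F x)) U" for n
  proof (induction n)
    case 0
    have "continuous_on U (\<lambda>x. sin (F x))" "continuous_on U (\<lambda>x. cos (F x))"
      by (rule continuous_on_compose2[OF continuous_on_sin[OF continuous_on_id, of UNIV] c]
          continuous_on_compose2[OF continuous_on_cos[OF continuous_on_id, of UNIV] c]; simp)+
    then show ?case by simp
  next
    case (Suc n)
    have "Ck_on (Suc n) (\<lambda>x. sin (F x)) U"
      by (rule Ck_on_chain[where h = sin and F = F and h' = cos, OF U DERIV_sin FS]) (use Suc in simp)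
    moreover have "Ck_on n (\<lambda>x. -1 * sin (F x)) U" using Suc by (intro Ck_on_mult U Ck_on_const) simp
    then have "Ck_on (Suc n) (\<lambda>x. cos (F x)) U"
      by (intro Ck_on_chain[where h = cos and F = F and h' = "\<lambda>t. -1 * sin t", OF U _ FS]) (auto intro!: derivative_eq_intros)
    ultimately show ?case by blast
  qed
  then show "smooth_on_open (\<lambda>x. sin (F x)) U" "smooth_on_open (\<lambda>x. cos (F x)) U"
    by (auto simp: smooth_on_open_def)
qed

text \<open>\<open>phi\<close> and \<open>chi\<close> gain regularity together, each derivative
  being a smooth coefficient times the other function.\<close>

lemma smooth_on_open_phi:
  assumes U: "open U" and F: "smooth_on_open F U"
  shows "smooth_on_open (\<lambda>x. phi l (F x)) U"
proof -
  have c: "continuous_on U F" by (rule smooth_on_open_continuous[OF F])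
  have FS: "Ck_on n F U" for n using F by (simp add: smooth_on_open_def)
  have "smooth_on_open (\<lambda>x. rad (F x)) U"
    unfolding rad_def by (intro smooth_on_open_add smooth_on_open_const smooth_on_open_sin_cos U F)
  moreover from this have "smooth_on_open (\<lambda>x. inverse (rad (F x))) U"
    by (intro smooth_on_open_inverse U) auto
  ultimately have r: "Ck_on n (\<lambda>x. rad (F x)) U" "Ck_on n (\<lambda>x. inverse (rad (F x))) U" for n
    by (auto simp: smooth_on_open_def)
  have "Ck_on n (\<lambda>x. phi l (F x)) U \<and> Ck_on n (\<lambda>x. chi l (F x)) U" for n
  proof (induction n)
    case 0
    show ?case using c by (auto intro!: continuous_intros)
  next
    case (Suc n)
    have "Ck_on n (\<lambda>x. inverse (rad (F x)) * chi l (F x)) U"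
      using Suc by (intro Ck_on_mult U r) auto
    moreover have "(phi l has_real_derivative inverse (rad t) * chi l t) (at t)" for t
      using DERIV_phi[of l t] by (simp add: divide_inverse)
    ultimately have "Ck_on (Suc n) (\<lambda>x. phi l (F x)) U"
      by (intro Ck_on_chain[OF U _ FS, where h' = "\<lambda>t. inverse (rad t) * chi l t"])
    moreover have "Ck_on n (\<lambda>x. (inverse (rad (F x)) + (- l) * rad (F x)) * phi l (F x)) U"
      using Suc by (intro Ck_on_mult Ck_on_add Ck_on_const U r) auto
    moreover have "(chi l has_real_derivative (inverse (rad t) + (- l) * rad t) * phi l t) (at t)" for t
      using DERIV_chi[of l t] by (simp add: divide_inverse)
    ultimately show ?case
      using Ck_on_chain[OF U _ FS, where h' = "\<lambda>t. (inverse (rad t) + (- l) * rad t) * phi l t" and h = "chi l"]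
      by blast
  qed
  then show ?thesis by (simp add: smooth_on_open_def)
qed

text \<open>The quotient is cos u, and the angle v is recovered by choice. Once \<open>phi\<close>
  is periodic the value does not depend on the choice.\<close>

definition torus_mode :: "real \<Rightarrow> real^3 \<Rightarrow> real" where
  "torus_mode l p = p$1 / sqrt ((p$1)\<^sup>2 + (p$2)\<^sup>2) *
     phi l (SOME v. sin v = p$3 \<and> cos v = sqrt ((p$1)\<^sup>2 + (p$2)\<^sup>2) - sqrt 2)"

lemma phi_cong_sin_cos:
  assumes "chi l pi = 0" "sin w = sin v" "cos w = cos v"
  shows "phi l w = phi l v"
proof -
  obtain n :: int where "w = v + 2 * pi * n" using sin_cos_eq_iff[of w v] assms(2,3) by auto
  then show ?thesis using periodic_int_shift[of "phi l", OF phi_periodic[OF assms(1)]] by simp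
qed

lemma torus_mode_torus_point:
  assumes "chi l pi = 0"
  shows "torus_mode l (torus_point u v) = cos u * phi l v"
proof -
  define w where "w = (SOME w. sin w = torus_point u v $ 3 \<and> cos w = rad v - sqrt 2)"
  have "sin v = torus_point u v $ 3 \<and> cos v = rad v - sqrt 2" by (simp add: torus_point_def rad_def)
  then have "sin w = torus_point u v $ 3 \<and> cos w = rad v - sqrt 2" unfolding w_def by (rule someI)
  then have "phi l w = phi l v" by (intro phi_cong_sin_cos assms) (simp_all add: torus_point_def rad_def)
  then show ?thesis unfolding torus_mode_def torus_point_radius w_def[symmetric]
    by (simp add: torus_point_def)
qed

lemma sin_cos_arctan_quotient:
  assumes "0 < c" "s\<^sup>2 + c\<^sup>2 = 1"
  shows "sin (arctan (s * inverse c)) = s" "cos (arctan (s * inverse c)) = c"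
proof -
  have "1 + (s * inverse c)\<^sup>2 = (s\<^sup>2 + c\<^sup>2) * (inverse c)\<^sup>2"
    using assms(1) by (simp add: field_simps)
  then have "sqrt (1 + (s * inverse c)\<^sup>2) = inverse c"
    using assms by simp
  then show "sin (arctan (s * inverse c)) = s" "cos (arctan (s * inverse c)) = c"
    using assms(1) unfolding sin_arctan cos_arctan by (simp_all add: field_simps)
qed

text \<open>The chosen angle need not be continuous, so near a point of angle b it is replaced by
  the smooth branch b + arctan (T/C), which is an equally valid angle for \<open>phi\<close> by
  periodicity.\<close>

lemma smooth_torus_mode:
  assumes l: "chi l pi = 0"
  shows "smooth_function_on torus_sqrt2 (torus_mode l)"
  unfolding smooth_function_on_def
proof
  fix p assume "p \<in> torus_sqrt2"
  then obtain a b where p: "p = torus_point a b" by (rule torus_point_exists)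
  define Q where "Q q = q$1 * q$1 + q$2 * q$2" for q :: "real^3"
  define V where "V = {q. 0 < Q q}"
  have nth: "bounded_linear (\<lambda>q::real^3. q $ i)" for i by (rule bounded_linear_vec_nth)
  have cQ: "continuous_on s Q" for s unfolding Q_def by (intro continuous_intros)
  have V: "open V" unfolding V_def by (intro open_Collect_less continuous_intros cQ)
  define R where "R q = sqrt (Q q)" for q
  \<comment> \<open>On the torus C and T equal cos (v - b) and sin (v - b); rotating by b places the
    base point where the cosine is 1, so \<open>0 < C\<close> describes a neighbourhood of
    it.\<close>
  define C where "C q = (R q + - sqrt 2) * cos b + q$3 * sin b" for q
  define T where "T q = q$3 * cos b + (R q + - sqrt 2) * (- sin b)" for q
  define U where "U = V \<inter> {q. 0 < C q}"
  have U: "open U" unfolding U_def V_def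
    by (intro open_Int open_Collect_less) (auto simp: C_def R_def intro!: continuous_intros cQ)
  have sR: "smooth_on_open R U"
    unfolding R_def[abs_def]
  proof (rule smooth_on_open_sqrt[OF U])
    show "smooth_on_open Q U" unfolding Q_def[abs_def]
      by (intro smooth_on_open_add smooth_on_open_mult smooth_on_open_linear U nth)
  qed (auto simp: U_def V_def)
  have sC: "smooth_on_open C U" and sT: "smooth_on_open T U"
    unfolding C_def[abs_def] T_def[abs_def]
    by (intro smooth_on_open_add smooth_on_open_mult smooth_on_open_const smooth_on_open_linear[OF U nth] U sR)+
  define F where "F q = q$1 * inverse (R q) * phi l (b + arctan (T q * inverse (C q)))" for q
  have "smooth_on_open F U" unfolding F_def[abs_def]
    by (intro smooth_on_open_phi smooth_on_open_arctan smooth_on_open_add smooth_on_open_mult smooth_on_open_const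
        smooth_on_open_inverse smooth_on_open_linear[OF U nth] U sR sC sT)
      (auto simp: U_def V_def R_def)
  moreover have RQ: "R (torus_point u v) = rad v" "0 < Q (torus_point u v)" for u v
  proof -
    show "R (torus_point u v) = rad v"
      unfolding R_def Q_def using torus_point_radius[of u v] by (simp add: power2_eq_square)
    then show "0 < Q (torus_point u v)" unfolding R_def using rad_pos(1)[of v] by (metis real_sqrt_gt_0_iff)
  qed
  have CT: "C (torus_point u v) = cos (v - b)" "T (torus_point u v) = sin (v - b)" for u v
    unfolding C_def T_def RQ by (simp_all add: torus_point_def rad_def cos_diff sin_diff)
  have "p \<in> U" unfolding U_def V_def p by (simp add: RQ CT)
  moreover have "F q = torus_mode l q" if qU: "q \<in> torus_sqrt2 \<inter> U" for q
  proof -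
    obtain u v where q: "q = torus_point u v" using qU torus_point_exists by blast
    have c: "0 < cos (v - b)" using qU unfolding q U_def by (simp add: CT)
    define t where "t = arctan (sin (v - b) * inverse (cos (v - b)))"
    have t: "sin t = sin (v - b)" "cos t = cos (v - b)"
      unfolding t_def by (rule sin_cos_arctan_quotient[OF c]; simp)+
    have "phi l (b + t) = phi l v"
    proof (rule phi_cong_sin_cos[OF l])
      have "sin (b + t) = sin (b + (v - b))" "cos (b + t) = cos (b + (v - b))"
        by (simp_all only: sin_add cos_add t)
      then show "sin (b + t) = sin v" "cos (b + t) = cos v" by simp_all
    qed
    then show ?thesis
      unfolding F_def q RQ CT t_def[symmetric] torus_mode_torus_point[OF l]
      by (simp add: torus_point_def)
  qed
  ultimately show "\<exists>U F. open U \<and> p \<in> U \<and> smooth_on_open F U \<and> (\<forall>q\<in>torus_sqrt2 \<inter> U. F q = torus_mode l q)"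
    using U by blast
qed

lemma laplacian_torus_mode:
  assumes l: "chi l pi = 0" and p: "p \<in> torus_sqrt2"
  shows "laplacian torus_sqrt2 (torus_mode l) p + l * torus_mode l p = 0"
proof -
  obtain u v where p: "p = torus_point u v" using p by (rule torus_point_exists)
  let ?f = "torus_mode l"
  have e: "?f (torus_point u v) = cos u * phi l v" for u v by (rule torus_mode_torus_point[OF l])
  have u1: "deriv (\<lambda>u. cos u * phi l v) = (\<lambda>u. - sin u * phi l v)" for v
    by (rule ext, rule DERIV_imp_deriv) (auto intro!: derivative_eq_intros)
  have u2: "deriv (\<lambda>u. - sin u * phi l v) u = - cos u * phi l v"
    by (rule DERIV_imp_deriv) (auto intro!: derivative_eq_intros)
  have v1: "deriv (\<lambda>v. cos u * phi l v) = (\<lambda>v. cos u * (chi l v / rad v))"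
    by (rule ext, rule DERIV_imp_deriv) (auto intro!: derivative_eq_intros)
  have v2: "deriv (\<lambda>v. cos u * (chi l v / rad v)) v =
      cos u * (((1 / rad v - l * rad v) * phi l v * rad v + chi l v * sin v) / (rad v * rad v))"
    by (rule DERIV_imp_deriv) (auto intro!: derivative_eq_intros simp: algebra_simps)
  have "du ?f u v = - sin u * phi l v" "duu ?f u v = - cos u * phi l v"
    "dv ?f u v = cos u * (chi l v / rad v)"
    "dvv ?f u v = cos u * (((1 / rad v - l * rad v) * phi l v * rad v + chi l v * sin v) / (rad v * rad v))"
    unfolding du_def duu_def dv_def dvv_def e by (simp_all only: u1 u2 v1 v2)
  then show ?thesis
    unfolding p laplacian_torus[OF smooth_torus_mode[OF l]] e
    by (simp only:) (simp add: field_simps power2_eq_square)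
qed

section \<open>The least positive eigenvalue\<close>

lemma laplace_eigenvalue_torus_mode:
  assumes "chi l pi = 0" shows "laplace_eigenvalue torus_sqrt2 l"
  unfolding laplace_eigenvalue_def
proof (intro exI conjI ballI)
  show "smooth_function_on torus_sqrt2 (torus_mode l)" by (rule smooth_torus_mode[OF assms])
  show "\<exists>p\<in>torus_sqrt2. torus_mode l p \<noteq> 0"
    by (rule bexI[of _ "torus_point 0 0"]) (simp_all add: torus_mode_torus_point[OF assms])
  show "laplacian torus_sqrt2 (torus_mode l) p + l * torus_mode l p = 0" if "p \<in> torus_sqrt2" for p
    by (rule laplacian_torus_mode[OF assms that])
qed

lemma not_laplace_eigenvalue_torus:
  assumes "subcritical l" "0 < l" "l < 4/9"
  shows "\<not> laplace_eigenvalue torus_sqrt2 l"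
proof
  assume "laplace_eigenvalue torus_sqrt2 l"
  then obtain f p where f: "smooth_function_on torus_sqrt2 f" and p: "p \<in> torus_sqrt2" "f p \<noteq> 0"
    and ev: "\<And>p. p \<in> torus_sqrt2 \<Longrightarrow> laplacian torus_sqrt2 f p + l * f p = 0"
    unfolding laplace_eigenvalue_def by blast
  obtain u v where uv: "p = torus_point u v" using p(1) by (rule torus_point_exists)
  have "f (torus_point u v) = 0"
  proof (rule small_eigenfunction_vanishes[OF second_partials_torus[OF f] _ _ _ assms])
    show "duu f u v / (rad v)\<^sup>2 + dvv f u v - sin v / rad v * dv f u v + l * f (torus_point u v) = 0" for u v
      using ev[OF torus_point_in[of u v]] unfolding laplacian_torus[OF f] .
  qed (simp_all add: torus_point_def)
  then show False using p uv by simp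
qed

theorem mainTheorem4:
  shows "first_eigenvalue torus_sqrt2 < 4 / 3 * (sqrt 2 - 1)"
proof -
  obtain l where l: "0 < l" "l \<le> 3/7" "chi l pi = 0" "\<And>l'. 0 \<le> l' \<Longrightarrow> l' < l \<Longrightarrow> subcritical l'"
    by (rule critical_parameter_exists) blast
  have "first_eigenvalue torus_sqrt2 = l"
    unfolding first_eigenvalue_def
  proof (rule Least_equality)
    show "0 < l \<and> laplace_eigenvalue torus_sqrt2 l"
      using l(1) laplace_eigenvalue_torus_mode[OF l(3)] by blast
    fix l' assume l': "0 < l' \<and> laplace_eigenvalue torus_sqrt2 l'"
    show "l \<le> l'"
    proof (rule ccontr)
      assume "\<not> l \<le> l'"
      \<comment> \<open>The bound 3/7 on the critical parameter is used here as well: it keeps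
        \<open>l'\<close> below 4/9, where symmetric eigenfunctions are excluded.\<close>
      then have "subcritical l'" "l' < 4/9" using l(2,4) l' by auto
      then show False using not_laplace_eigenvalue_torus l' by blast
    qed
  qed
  \<comment> \<open>Gives 4/3 (sqrt 2 - 1) >= 8/15, which exceeds 3/7.\<close>
  moreover have "7/5 \<le> sqrt (2::real)" by (rule real_le_rsqrt) (simp add: power2_eq_square)
  ultimately show ?thesis using l(2) by simp
qed

end
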